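(* Let $g \geqslant 3$ be an integer and let $$\gamma_g = g \min_{m=1,2,\ldots} \left(\frac{2g}{m\,\varphi(g)\log g}\right)^{1/m}.$$ Then there is an absolute constant $C>0$ such that for all sufficiently large $N$ we have $P_g(N) \leqslant C\,\gamma_g^N$.
   Context: Here $\varphi$ is Euler's totient function. For a finite tuple of $g$-ary digits $(d_0,\ldots,d_{N-1}) \in \{0,\ldots,g-1\}^N$ with $d_{N-1} \neq 0$ (equivalently, an infinite digit sequence $\mathcal{D}=\{d_i\}_{i\ge 0}$ whose last non-zero element is $d_{N-1}$; such $\mathcal{D}$ is said to have length $N$), define $u_{\mathcal{D},g}(n) = \sum_{i=0}^{n-1} d_i g^i$ and let $\varpi_{\mathcal{D},g}(N)$ be the number of $n$ with $1 \leqslant n \leqslant N$ for which $u_{\mathcal{D},g}(n)$ is prime. Let $\eta = 1$ if $g=2$ and $\eta = 0$ if $g \geqslant 3$. Then $P_g(N)$ denotes the number of sequences $\mathcal{D}$ of length $N$ such that $\varpi_{\mathcal{D},g}(N) = N - \eta$. *)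

theory Defs
  imports Complex_Main "HOL-Number_Theory.Totient" "HOL-Real_Asymp.Real_Asymp"
begin

definition digit_seqs :: "nat \<Rightarrow> nat \<Rightarrow> (nat \<Rightarrow> nat) set" where
  "digit_seqs g N = {d. (\<forall>i. d i < g) \<and> N \<ge> 1 \<and> d (N - 1) \<noteq> 0 \<and> (\<forall>i\<ge>N. d i = 0)}"

definition trunc :: "(nat \<Rightarrow> nat) \<Rightarrow> nat \<Rightarrow> nat \<Rightarrow> nat" where
  "trunc d g n = (\<Sum>i<n. d i * g ^ i)"

definition prime_trunc_count :: "(nat \<Rightarrow> nat) \<Rightarrow> nat \<Rightarrow> nat \<Rightarrow> nat" where
  "prime_trunc_count d g N = card {n \<in> {1..N}. prime (trunc d g n)}"

definition eta :: "nat \<Rightarrow> nat" where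
  "eta g = (if g = 2 then 1 else 0)"

definition P_count :: "nat \<Rightarrow> nat \<Rightarrow> nat" where
  "P_count g N = card {d \<in> digit_seqs g N. prime_trunc_count d g N = N - eta g}"

lemma finite_digit_seqs: "finite (digit_seqs g N)"
proof (rule finite_subset)
  show "digit_seqs g N \<subseteq>
      {d. \<forall>i. (i \<in> {..<N} \<longrightarrow> d i \<in> {..<g}) \<and> (i \<notin> {..<N} \<longrightarrow> d i = 0)}"
    by (auto simp: digit_seqs_def)
  show "finite {d. \<forall>i. (i \<in> {..<N} \<longrightarrow> d i \<in> {..<g}) \<and> (i \<notin> {..<N} \<longrightarrow> d i = 0)}"
    by (rule finite_set_of_finite_funs) auto
qed

definition gamma_term :: "nat \<Rightarrow> nat \<Rightarrow> real" where
  "gamma_term g m = (2 * real g / (real m * real (totient g) * ln (real g))) powr (1 / real m)"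

text \<open>The infimum below is a minimum: see \<open>gamma_min_attained\<close>.\<close>

definition gamma_const :: "nat \<Rightarrow> real" where
  "gamma_const g = real g * (INF m\<in>{1..}. gamma_term g m)"

lemma gamma_min_attained:
  assumes "g \<ge> 3"
  shows "\<exists>m\<ge>1. (\<forall>k\<ge>1. gamma_term g m \<le> gamma_term g k) \<and> gamma_const g = real g * gamma_term g m"
proof -
  define c where "c = 2 * real g / (real (totient g) * ln (real g))"
  have c: "c > 0" using assms by (simp add: c_def)
  have eq: "gamma_term g m = (c / real m) powr (1 / real m)" for m
    by (simp add: gamma_term_def c_def field_simps)
  have "((\<lambda>m::nat. (c / real m) powr (1 / real m)) \<longlongrightarrow> 1) at_top"
    using c by real_asymp
  then have lim: "gamma_term g \<longlonglongrightarrow> 1" by (simp add: eq[abs_def])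
  obtain m0 :: nat where m0: "c < real m0" using reals_Archimedean2 by blast
  then have m01: "m0 \<ge> 1" using c by (cases m0) auto
  have "gamma_term g m0 < 1"
    unfolding eq using m0 m01 c powr_less_mono2[of "1 / real m0" "c / real m0" 1] by simp
  from order_tendstoD(1)[OF lim this] obtain K where
    K: "\<And>k. k \<ge> K \<Longrightarrow> gamma_term g m0 < gamma_term g k"
    by (auto simp: eventually_at_top_linorder)
  define S where "S = {1..max K m0}"
  have S: "finite S" "m0 \<in> S" using m01 by (auto simp: S_def)
  obtain m where m: "m \<in> S" "\<And>k. k \<in> S \<Longrightarrow> gamma_term g m \<le> gamma_term g k"
    using S arg_min_if_finite(1)[of S "gamma_term g"] arg_min_least[of S _ "gamma_term g"] by blast
  have min: "gamma_term g m \<le> gamma_term g k" if "k \<ge> 1" for k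
  proof (cases "k \<in> S")
    case False
    then have "k \<ge> K" using that by (auto simp: S_def)
    then show ?thesis using K[of k] m(2)[OF S(2)] by linarith
  qed (use m in auto)
  have m1: "m \<ge> 1" using m(1) by (auto simp: S_def)
  have "(INF m\<in>{1..}. gamma_term g m) = gamma_term g m"
    by (rule cInf_eq_minimum) (use m1 min in auto)
  then show ?thesis using m1 min by (auto simp: gamma_const_def)
qed

end

theory Submission
  imports Defs "HOL-Analysis.Harmonic_Numbers"
begin

text \<open>
  Let \<open>m\<close> attain the minimum in \<open>\<gamma>\<^sub>g\<close> and put \<open>Y = g\<^sup>m\<close>. A number \<open>u < g\<^sup>N\<close>, all of whose truncations
  \<open>u mod g\<^sup>n\<close> are prime, is prolonged by \<open>m\<close> digits by choosing \<open>j < Y\<close> such that \<open>u + j g\<^sup>N\<close> is prime,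
  and the Brun--Titchmarsh inequality allows fewer than \<open>\<gamma>\<^sub>g\<^sup>m = (g / \<phi>(g)) \<cdot> 2 Y / log Y\<close> such \<open>j\<close>
  once \<open>u > Y\<close>. The bound is a strict inequality between an integer and a number depending only
  on \<open>g\<close>, so the growth rate of the number of these \<open>u\<close> is strictly smaller than \<open>\<gamma>\<^sub>g\<close>. This absorbs
  the boundedly many \<open>u \<le> Y\<close> and the dependence of all constants on \<open>g\<close>; one may take \<open>C = 1\<close>.

  In an arithmetic progression modulo \<open>q\<close>, the \<open>j\<close> giving primes avoid a residue class modulo every
  prime \<open>p\<close> not dividing \<open>q\<close>. For \<open>p\<close> dividing \<open>q\<close> one deletes the least populated class.
  Altogether a proportion of at least \<open>\<phi>(q) / q\<close> of the \<open>j\<close> survives, and it remains to show that a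
  subset of an interval of length \<open>Y\<close> avoiding one class modulo every prime \<open>p \<le> Y\<close> has fewer than
  \<open>2 Y / log Y\<close> elements. The constant \<open>2\<close> has to be exact, since a loss would be raised to the power
  \<open>N / m\<close>. Splitting into the two surviving classes modulo \<open>6\<close> before applying Selberg's sieve of
  level \<open>z = \<surd>Y / 3\<close> makes the gain from the secondary term of \<open>\<Sum> 1 / d\<close> (over \<open>d \<le> z\<close> coprime to \<open>6\<close>)
  exceed the error term. For \<open>Y \<le> 9000\<close> sieving by at most the primes \<open>2, 3, 5, 7, 11, 13\<close> suffices.
\<close>

section \<open>Selberg's sieve\<close>

lemma sum_alternating_between:
  assumes "finite G" "E \<subseteq> G"
  shows "(\<Sum>F | E \<subseteq> F \<and> F \<subseteq> G. (-1 :: 'b :: ring_1) ^ card F) = (if E = G then (-1) ^ card E else 0)"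
proof (cases "E = G")
  case True
  then have "{F. E \<subseteq> F \<and> F \<subseteq> G} = {E}" by auto
  then show ?thesis using True by simp
next
  case False
  then have "E \<subset> G" using assms(2) by blast
  then have "(\<Sum>F | F \<subseteq> G \<and> E \<subseteq> F. (-1 :: 'b) ^ card F) = 0"
    using card_subsupersets_even_odd[OF assms(1)] assms(1)
    by (intro sum_alternating_cancels) auto
  then show ?thesis using False by (simp add: conj_commute)
qed

locale finite_downset =
  fixes D :: "'a set set"
  assumes finite_Union: "finite (\<Union>D)"
    and empty_mem: "{} \<in> D"
    and subset_mem: "F \<in> D \<Longrightarrow> E \<subseteq> F \<Longrightarrow> E \<in> D"
begin

lemma finite_family: "finite D"
  using finite_Union by (rule finite_UnionD)

lemma finite_mem: "F \<in> D \<Longrightarrow> finite F"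
  using finite_Union by (blast intro: finite_subset)

lemma Pow_eq_mem_subset: "E \<in> D \<Longrightarrow> Pow E = {F. F \<in> D \<and> F \<subseteq> E}"
  using subset_mem by blast

lemma sum_supersets_swap:
  "(\<Sum>F\<in>D. \<Sum>E | E \<in> D \<and> F \<subseteq> E. f F E) = (\<Sum>E\<in>D. \<Sum>F\<in>Pow E. f F E)"
  by (rule trans[OF sum.swap_restrict[OF finite_family finite_family]])
    (simp add: Pow_eq_mem_subset)

lemma sum_prod_add_one:
  fixes f :: "'a \<Rightarrow> 'b :: comm_semiring_1"
  shows "(\<Sum>E\<in>D. \<Prod>p\<in>E. f p + 1) = (\<Sum>F\<in>D. of_nat (card {E \<in> D. F \<subseteq> E}) * prod f F)"
proof -
  have "(\<Sum>E\<in>D. \<Prod>p\<in>E. f p + 1) = (\<Sum>E\<in>D. \<Sum>F\<in>Pow E. prod f F)"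
    by (intro sum.cong refl, subst prod_add) (auto intro: finite_mem)
  then show ?thesis by (simp flip: sum_supersets_swap)
qed

lemma sum_prod_le_prod_add_one:
  fixes f :: "'a \<Rightarrow> 'b :: linordered_idom"
  assumes "\<And>p. p \<in> \<Union>D \<Longrightarrow> 0 \<le> f p"
  shows "(\<Sum>F\<in>D. prod f F) \<le> (\<Prod>p\<in>\<Union>D. f p + 1)"
proof -
  have "(\<Sum>F\<in>D. prod f F) \<le> (\<Sum>F\<in>Pow (\<Union>D). prod f F)"
    using finite_Union assms by (intro sum_mono2 prod_nonneg) blast+
  then show ?thesis using finite_Union by (simp add: prod_add)
qed

lemma moebius_inversion_supersets:
  fixes y :: "'a set \<Rightarrow> 'b :: comm_ring_1"
  assumes E: "E \<in> D"
  shows "(\<Sum>F | F \<in> D \<and> E \<subseteq> F. (-1) ^ card F * (\<Sum>G | G \<in> D \<and> F \<subseteq> G. y G)) = (-1) ^ card E * y E"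
proof -
  have "(\<Sum>F | F \<in> D \<and> E \<subseteq> F. (-1) ^ card F * (\<Sum>G | G \<in> D \<and> F \<subseteq> G. y G)) =
      (\<Sum>G\<in>D. \<Sum>F | F \<in> {F. F \<in> D \<and> E \<subseteq> F} \<and> F \<subseteq> G. (-1) ^ card F * y G)"
    unfolding sum_distrib_left using finite_family by (intro sum.swap_restrict) auto
  also have "\<dots> = (\<Sum>G\<in>D. if E = G then (-1) ^ card E * y E else 0)"
  proof (intro sum.cong refl)
    fix G assume G: "G \<in> D"
    have "{F. F \<in> {F. F \<in> D \<and> E \<subseteq> F} \<and> F \<subseteq> G} = {F. E \<subseteq> F \<and> F \<subseteq> G}"
      using subset_mem[OF G] by auto
    moreover have "(\<Sum>F | E \<subseteq> F \<and> F \<subseteq> G. (-1 :: 'b) ^ card F) = (if E = G then (-1) ^ card E else 0)"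
    proof (cases "E \<subseteq> G")
      case True
      then show ?thesis using sum_alternating_between finite_mem[OF G] by blast
    next
      case False
      then have "{F. E \<subseteq> F \<and> F \<subseteq> G} = {}" "E \<noteq> G" by blast+
      then show ?thesis by (simp del: Collect_empty_eq)
    qed
    ultimately show "(\<Sum>F | F \<in> {F. F \<in> D \<and> E \<subseteq> F} \<and> F \<subseteq> G. (-1) ^ card F * y G) =
        (if E = G then (-1) ^ card E * y E else 0)"
      by (simp flip: sum_distrib_right)
  qed
  also have "\<dots> = (-1) ^ card E * y E" using E finite_family by simp
  finally show ?thesis .
qed

lemma card_sifted_le_quadratic_form:
  fixes x :: "'a set \<Rightarrow> real" and bad :: "'a \<Rightarrow> 'b \<Rightarrow> bool"
  assumes A: "finite A" and x: "x {} = 1"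
  shows "real (card {t \<in> A. \<forall>p\<in>\<Union>D. \<not> bad p t}) \<le>
    (\<Sum>F\<in>D. \<Sum>G\<in>D. x F * x G * real (card {t \<in> A. \<forall>p\<in>F \<union> G. bad p t}))"
proof -
  define b where "b F t = (of_bool (\<forall>p\<in>F. bad p t) :: real)" for F t
  have b_Un: "b (F \<union> G) t = b F t * b G t" for F G t
    by (auto simp: b_def)
  have "real (card {t \<in> A. \<forall>p\<in>\<Union>D. \<not> bad p t}) = (\<Sum>t\<in>A. of_bool (\<forall>p\<in>\<Union>D. \<not> bad p t))"
    using A by (simp add: Int_def)
  also have "\<dots> \<le> (\<Sum>t\<in>A. (\<Sum>F\<in>D. x F * b F t)\<^sup>2)"
  proof (intro sum_mono)
    fix t
    have "(\<Sum>F\<in>D. x F * b F t) = 1" if "\<forall>p\<in>\<Union>D. \<not> bad p t"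
    proof -
      have "(\<Sum>F\<in>D. x F * b F t) = (\<Sum>F\<in>D. if F = {} then 1 else 0)"
        using that x by (intro sum.cong refl) (auto simp: b_def)
      then show ?thesis using finite_family empty_mem by simp
    qed
    then show "of_bool (\<forall>p\<in>\<Union>D. \<not> bad p t) \<le> (\<Sum>F\<in>D. x F * b F t)\<^sup>2"
      by (simp add: of_bool_def)
  qed
  also have "\<dots> = (\<Sum>t\<in>A. \<Sum>F\<in>D. \<Sum>G\<in>D. x F * x G * b (F \<union> G) t)"
    by (simp add: power2_eq_square sum_product b_Un mult_ac)
  also have "\<dots> = (\<Sum>F\<in>D. \<Sum>G\<in>D. \<Sum>t\<in>A. x F * x G * b (F \<union> G) t)"
    by (rule trans[OF sum.swap sum.cong[OF refl sum.swap]])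
  also have "\<dots> = (\<Sum>F\<in>D. \<Sum>G\<in>D. x F * x G * real (card {t \<in> A. \<forall>p\<in>F \<union> G. bad p t}))"
    using A by (simp add: b_def Int_def flip: sum_distrib_left)
  finally show ?thesis .
qed

end

definition selberg_main_sum :: "('a \<Rightarrow> real) \<Rightarrow> 'a set set \<Rightarrow> real" where
  "selberg_main_sum m D = (\<Sum>E\<in>D. \<Prod>p\<in>E. 1 / (m p - 1))"

definition selberg_error_sum :: "('a \<Rightarrow> real) \<Rightarrow> 'a set set \<Rightarrow> real" where
  "selberg_error_sum m D = (\<Sum>E\<in>D. \<Prod>p\<in>E. (m p + 1) / (m p - 1))"

locale selberg_sieve = finite_downset D for D :: "'a set set" +
  fixes m :: "'a \<Rightarrow> real"
  assumes norm_gt_1: "p \<in> \<Union>D \<Longrightarrow> 1 < m p"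
begin

lemma mem_norm_gt_1: "E \<in> D \<Longrightarrow> p \<in> E \<Longrightarrow> 1 < m p"
  using norm_gt_1 by blast

lemma prod_norm_pos: "E \<in> D \<Longrightarrow> 0 < prod m E"
  using mem_norm_gt_1 by (intro prod_pos) (meson less_trans zero_less_one)

lemma prod_recip_pos: "E \<in> D \<Longrightarrow> 0 < (\<Prod>p\<in>E. 1 / (m p - 1))"
  using mem_norm_gt_1 by (intro prod_pos) simp

lemma selberg_main_sum_pos: "0 < selberg_main_sum m D"
  unfolding selberg_main_sum_def
  by (rule sum_pos[OF finite_family]) (use empty_mem prod_recip_pos in blast)+

lemma selberg_error_sum_nonneg: "0 \<le> selberg_error_sum m D"
  unfolding selberg_error_sum_def
proof (intro sum_nonneg prod_nonneg)
  fix E p assume "E \<in> D" "p \<in> E"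
  then have "1 < m p" by (rule mem_norm_gt_1)
  then show "0 \<le> (m p + 1) / (m p - 1)" by simp
qed

lemma inverse_prod_norm_Un:
  assumes FG: "F \<in> D" "G \<in> D"
  shows "1 / prod m (F \<union> G) = (\<Sum>E | E \<in> D \<and> E \<subseteq> F \<and> E \<subseteq> G. \<Prod>p\<in>E. m p - 1) / (prod m F * prod m G)"
proof -
  have "F \<inter> G \<in> D" using FG(1) by (rule subset_mem) simp
  have "prod m (F \<inter> G) = (\<Prod>p\<in>F \<inter> G. (m p - 1) + 1)" by simp
  also have "\<dots> = (\<Sum>E\<in>Pow (F \<inter> G). \<Prod>p\<in>E. m p - 1)"
    by (subst prod_add) (use finite_mem FG in auto)
  also have "Pow (F \<inter> G) = {E. E \<in> D \<and> E \<subseteq> F \<and> E \<subseteq> G}"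
    using Pow_eq_mem_subset[OF \<open>F \<inter> G \<in> D\<close>] by auto
  finally have "prod m (F \<inter> G) = (\<Sum>E | E \<in> D \<and> E \<subseteq> F \<and> E \<subseteq> G. \<Prod>p\<in>E. m p - 1)" .
  moreover have "prod m (F \<union> G) * prod m (F \<inter> G) = prod m F * prod m G"
    using finite_mem FG by (intro prod.union_inter) auto
  then have "prod m (F \<union> G) = prod m F * prod m G / prod m (F \<inter> G)"
    using prod_norm_pos[OF \<open>F \<inter> G \<in> D\<close>] by (simp add: nonzero_eq_divide_eq)
  ultimately show ?thesis by simp
qed

lemma quadratic_form_diagonal:
  "(\<Sum>F\<in>D. \<Sum>G\<in>D. x F * x G / prod m (F \<union> G)) =
    (\<Sum>E\<in>D. (\<Prod>p\<in>E. m p - 1) * (\<Sum>F | F \<in> D \<and> E \<subseteq> F. x F / prod m F)\<^sup>2)"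
proof -
  define y where "y F E = (if E \<subseteq> F then x F / prod m F else 0)" for E F
  have "x F * x G / prod m (F \<union> G) = (\<Sum>E\<in>D. (\<Prod>p\<in>E. m p - 1) * (y F E * y G E))"
    if "F \<in> D" "G \<in> D" for F G
  proof -
    have "x F * x G / prod m (F \<union> G) = x F * x G * (1 / prod m (F \<union> G))" by simp
    also have "\<dots> = (\<Sum>E | E \<in> D \<and> E \<subseteq> F \<and> E \<subseteq> G. (\<Prod>p\<in>E. m p - 1) * (y F E * y G E))"
      unfolding inverse_prod_norm_Un[OF that] sum_divide_distrib sum_distrib_left
      by (intro sum.cong refl) (simp add: y_def)
    also have "\<dots> = (\<Sum>E\<in>D. (\<Prod>p\<in>E. m p - 1) * (y F E * y G E))"
      using finite_family by (intro sum.mono_neutral_left) (auto simp: y_def)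
    finally show ?thesis .
  qed
  then have "(\<Sum>F\<in>D. \<Sum>G\<in>D. x F * x G / prod m (F \<union> G)) =
      (\<Sum>F\<in>D. \<Sum>G\<in>D. \<Sum>E\<in>D. (\<Prod>p\<in>E. m p - 1) * (y F E * y G E))"
    by simp
  also have "\<dots> = (\<Sum>E\<in>D. \<Sum>F\<in>D. \<Sum>G\<in>D. (\<Prod>p\<in>E. m p - 1) * (y F E * y G E))"
    by (rule trans[OF sum.cong[OF refl sum.swap] sum.swap])
  also have "\<dots> = (\<Sum>E\<in>D. (\<Prod>p\<in>E. m p - 1) * (\<Sum>F\<in>D. y F E)\<^sup>2)"
    by (simp add: power2_eq_square sum_product flip: sum_distrib_left)
  finally show ?thesis using finite_family by (simp add: y_def sum.inter_filter)
qed

text \<open>The minimiser of the quadratic form in \<open>quadratic_form_diagonal\<close> subject to \<open>x {} = 1\<close>.\<close>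

definition selberg_weight :: "'a set \<Rightarrow> real" where
  "selberg_weight F = (-1) ^ card F * prod m F *
    (\<Sum>E | E \<in> D \<and> F \<subseteq> E. \<Prod>p\<in>E. 1 / (m p - 1)) / selberg_main_sum m D"

lemma selberg_weight_empty: "selberg_weight {} = 1"
  using selberg_main_sum_pos by (simp add: selberg_weight_def selberg_main_sum_def)

lemma sum_selberg_weight_supersets:
  assumes "E \<in> D"
  shows "(\<Sum>F | F \<in> D \<and> E \<subseteq> F. selberg_weight F / prod m F) =
    (-1) ^ card E * (\<Prod>p\<in>E. 1 / (m p - 1)) / selberg_main_sum m D"
proof -
  have "(\<Sum>F | F \<in> D \<and> E \<subseteq> F. selberg_weight F / prod m F) =
      (\<Sum>F | F \<in> D \<and> E \<subseteq> F. (-1) ^ card F * (\<Sum>G | G \<in> D \<and> F \<subseteq> G. \<Prod>p\<in>G. 1 / (m p - 1)))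
        / selberg_main_sum m D"
    unfolding sum_divide_distrib
    by (intro sum.cong refl) (auto simp: selberg_weight_def dest: prod_norm_pos)
  then show ?thesis unfolding moebius_inversion_supersets[OF assms] .
qed

lemma quadratic_form_selberg_weight:
  "(\<Sum>F\<in>D. \<Sum>G\<in>D. selberg_weight F * selberg_weight G / prod m (F \<union> G)) = 1 / selberg_main_sum m D"
proof -
  let ?L = "selberg_main_sum m D"
  have "(\<Prod>p\<in>E. m p - 1) * (\<Sum>F | F \<in> D \<and> E \<subseteq> F. selberg_weight F / prod m F)\<^sup>2 =
      (\<Prod>p\<in>E. 1 / (m p - 1)) / ?L\<^sup>2" if E: "E \<in> D" for E
  proof -
    define w where "w = (\<Prod>p\<in>E. 1 / (m p - 1))"
    have "(\<Prod>p\<in>E. m p - 1) * w = 1"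
      unfolding w_def prod.distrib[symmetric]
      by (intro prod.neutral) (use mem_norm_gt_1[OF E] in fastforce)
    then have "(\<Prod>p\<in>E. m p - 1) * ((-1) ^ card E * w / ?L)\<^sup>2 = w / ?L\<^sup>2"
      by (simp add: power_mult_distrib power_divide power2_eq_square flip: power_add)
    then show ?thesis unfolding sum_selberg_weight_supersets[OF E] w_def .
  qed
  then have "(\<Sum>F\<in>D. \<Sum>G\<in>D. selberg_weight F * selberg_weight G / prod m (F \<union> G)) =
      (\<Sum>E\<in>D. (\<Prod>p\<in>E. 1 / (m p - 1)) / ?L\<^sup>2)"
    by (simp add: quadratic_form_diagonal)
  then show ?thesis
    using selberg_main_sum_pos
    by (simp add: power2_eq_square flip: sum_divide_distrib selberg_main_sum_def)
qed

lemma sum_abs_selberg_weight: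
  "(\<Sum>F\<in>D. \<bar>selberg_weight F\<bar>) = selberg_error_sum m D / selberg_main_sum m D"
proof -
  let ?L = "selberg_main_sum m D"
  let ?w = "\<lambda>E. \<Prod>p\<in>E. 1 / (m p - 1)"
  have "(\<Sum>F\<in>D. \<bar>selberg_weight F\<bar>) = (\<Sum>F\<in>D. \<Sum>E | E \<in> D \<and> F \<subseteq> E. prod m F * ?w E / ?L)"
  proof (intro sum.cong refl)
    fix F assume F: "F \<in> D"
    have "(\<Sum>E | E \<in> D \<and> F \<subseteq> E. ?w E) \<ge> 0"
      using prod_recip_pos by (intro sum_nonneg) (auto intro: less_imp_le)
    then have "\<bar>selberg_weight F\<bar> = prod m F * (\<Sum>E | E \<in> D \<and> F \<subseteq> E. ?w E) / ?L"
      using prod_norm_pos[OF F] selberg_main_sum_pos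
      by (simp add: selberg_weight_def abs_mult power_abs)
    then show "\<bar>selberg_weight F\<bar> = (\<Sum>E | E \<in> D \<and> F \<subseteq> E. prod m F * ?w E / ?L)"
      by (simp only: sum_distrib_left sum_divide_distrib)
  qed
  also have "\<dots> = (\<Sum>E\<in>D. (\<Sum>F\<in>Pow E. prod m F) * ?w E / ?L)"
    unfolding sum_supersets_swap by (simp add: sum_distrib_right sum_divide_distrib)
  also have "\<dots> = (\<Sum>E\<in>D. (\<Prod>p\<in>E. m p + 1) * ?w E / ?L)"
    using finite_mem by (intro sum.cong refl) (simp add: prod_add)
  also have "\<dots> = selberg_error_sum m D / ?L"
    by (simp add: selberg_error_sum_def sum_divide_distrib flip: prod.distrib)
  finally show ?thesis .
qed

theorem selberg_upper_bound:
  fixes A :: "'b set" and bad :: "'a \<Rightarrow> 'b \<Rightarrow> bool" and X r :: real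
  assumes A: "finite A"
    and equidistributed: "\<And>F. F \<subseteq> \<Union>D \<Longrightarrow> \<bar>real (card {t \<in> A. \<forall>p\<in>F. bad p t}) - X / prod m F\<bar> \<le> r"
  shows "real (card {t \<in> A. \<forall>p\<in>\<Union>D. \<not> bad p t}) \<le>
    X / selberg_main_sum m D + r * (selberg_error_sum m D / selberg_main_sum m D)\<^sup>2"
proof -
  let ?x = selberg_weight
  have "real (card {t \<in> A. \<forall>p\<in>\<Union>D. \<not> bad p t}) \<le>
      (\<Sum>F\<in>D. \<Sum>G\<in>D. ?x F * ?x G * real (card {t \<in> A. \<forall>p\<in>F \<union> G. bad p t}))"
    using A selberg_weight_empty by (rule card_sifted_le_quadratic_form)
  also have "\<dots> \<le> (\<Sum>F\<in>D. \<Sum>G\<in>D. X * (?x F * ?x G / prod m (F \<union> G)) + r * (\<bar>?x F\<bar> * \<bar>?x G\<bar>))"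
  proof (intro sum_mono)
    fix F G assume "F \<in> D" "G \<in> D"
    define error where "error = real (card {t \<in> A. \<forall>p\<in>F \<union> G. bad p t}) - X / prod m (F \<union> G)"
    have "\<bar>error\<bar> \<le> r" using \<open>F \<in> D\<close> \<open>G \<in> D\<close> equidistributed[of "F \<union> G"] by (auto simp: error_def)
    then have "\<bar>?x F * ?x G * error\<bar> \<le> \<bar>?x F * ?x G\<bar> * r"
      unfolding abs_mult[of _ error] by (intro mult_left_mono) auto
    then have "?x F * ?x G * error \<le> r * (\<bar>?x F\<bar> * \<bar>?x G\<bar>)"
      using abs_ge_self[of "?x F * ?x G * error"] by (simp add: abs_mult mult_ac)
    then show "?x F * ?x G * real (card {t \<in> A. \<forall>p\<in>F \<union> G. bad p t}) \<le>
        X * (?x F * ?x G / prod m (F \<union> G)) + r * (\<bar>?x F\<bar> * \<bar>?x G\<bar>)"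
      by (simp add: error_def algebra_simps)
  qed
  also have "\<dots> = X * (\<Sum>F\<in>D. \<Sum>G\<in>D. ?x F * ?x G / prod m (F \<union> G)) + r * (\<Sum>F\<in>D. \<bar>?x F\<bar>)\<^sup>2"
    unfolding power2_eq_square sum_product by (simp only: sum.distrib sum_distrib_left)
  finally show ?thesis by (simp add: quadratic_form_selberg_weight sum_abs_selberg_weight)
qed

end

section \<open>Sieving residue classes\<close>

lemma card_residue_class_bounds:
  fixes Y q r :: nat
  assumes "q > 0"
  shows "\<bar>real (card {t. t < Y \<and> [t = r] (mod q)}) - real Y / real q\<bar> \<le> 1"
proof -
  define s where "s = r mod q"
  define K where "K = (Y + (q - 1 - s)) div q"
  have s: "s < q" using assms by (simp add: s_def)
  have less_iff: "s + k * q < Y \<longleftrightarrow> k < K" for k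
  proof -
    have "k < K \<longleftrightarrow> Suc k * q \<le> Y + (q - 1 - s)"
      unfolding K_def using assms by (simp add: less_eq_div_iff_mult_less_eq flip: Suc_le_eq)
    then show ?thesis using s by auto
  qed
  have "{t. t < Y \<and> [t = r] (mod q)} = (\<lambda>k. s + k * q) ` {..<K}"
  proof (intro equalityI subsetI)
    fix t assume t: "t \<in> {t. t < Y \<and> [t = r] (mod q)}"
    then have "t < Y" "t mod q = s" by (simp_all add: Cong.cong_def s_def)
    then have "t = s + t div q * q" using mod_div_mult_eq[of t q] by simp
    moreover from this have "t div q < K" using less_iff[of "t div q"] \<open>t < Y\<close> by simp
    ultimately show "t \<in> (\<lambda>k. s + k * q) ` {..<K}" by blast
  next
    fix t assume "t \<in> (\<lambda>k. s + k * q) ` {..<K}"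
    then obtain k where "k < K" "t = s + k * q" by blast
    moreover have "(s + k * q) mod q = s" using s by simp
    ultimately show "t \<in> {t. t < Y \<and> [t = r] (mod q)}"
      using less_iff[of k] by (simp add: Cong.cong_def s_def)
  qed
  moreover have "inj_on (\<lambda>k. s + k * q) {..<K}" using assms by (auto simp: inj_on_def)
  ultimately have card: "card {t. t < Y \<and> [t = r] (mod q)} = K" by (simp add: card_image)
  have "K * q \<le> Y + (q - 1 - s)" unfolding K_def by simp
  moreover have "Y + (q - 1 - s) < K * q + q"
    unfolding K_def using assms by (metis add.commute dividend_less_div_times)
  ultimately have "K * q \<le> Y + q" "Y \<le> K * q + q" using s by simp_all
  then have "real K * real q \<le> real Y + real q" "real Y \<le> real K * real q + real q"
    by (simp_all flip: of_nat_add of_nat_mult)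
  then show ?thesis unfolding card using assms by (auto simp: abs_le_iff field_simps)
qed

lemma card_simultaneous_residues_bounds:
  fixes F :: "nat set" and a :: "nat \<Rightarrow> nat"
  assumes F: "finite F" "pairwise coprime F" "0 \<notin> F"
  shows "\<bar>real (card {t. t < Y \<and> (\<forall>p\<in>F. [t = a p] (mod p))}) - real Y / real (\<Prod>F)\<bar> \<le> 1"
proof -
  have coprime: "coprime p q" if "p \<in> F" "q \<in> F" "p \<noteq> q" for p q
    using F(2) that by (rule pairwiseD)
  obtain x where x: "\<forall>p\<in>F. [x = a p] (mod p)"
    using chinese_remainder_nat[of F "\<lambda>p. p" a] F(1) coprime by blast
  have "(\<forall>p\<in>F. [t = a p] (mod p)) \<longleftrightarrow> [t = x] (mod \<Prod>F)" for t
  proof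
    assume "\<forall>p\<in>F. [t = a p] (mod p)"
    then show "[t = x] (mod \<Prod>F)"
      using x by (intro coprime_cong_prod_nat coprime) (auto simp: Cong.cong_def)
  next
    assume "[t = x] (mod \<Prod>F)"
    then show "\<forall>p\<in>F. [t = a p] (mod p)"
      using x F(1) cong_dvd_modulus_nat[of t x "\<Prod>F"] by (auto intro: cong_trans dvd_prodI)
  qed
  moreover have "\<Prod>F > 0" using F(3) by (intro prod_pos) (metis gr0I)
  ultimately show ?thesis using card_residue_class_bounds by (simp del: of_nat_prod)
qed

definition sifted :: "nat set \<Rightarrow> nat set \<Rightarrow> (nat \<Rightarrow> nat) \<Rightarrow> nat set" where
  "sifted A P a = {t \<in> A. \<forall>p\<in>P. \<not> [t = a p] (mod p)}"

lemma sifted_subset: "sifted A P a \<subseteq> A"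
  by (auto simp: sifted_def)

lemma finite_sifted: "finite A \<Longrightarrow> finite (sifted A P a)"
  using sifted_subset by (rule finite_subset)

lemma sifted_antimono: "P \<subseteq> Q \<Longrightarrow> sifted A Q a \<subseteq> sifted A P a"
  by (auto simp: sifted_def)

lemma card_sifted_progression_le:
  fixes D :: "nat set set" and a :: "nat \<Rightarrow> nat" and q r Y :: nat
  assumes "finite_downset D" and "q > 0"
    and coprime: "pairwise coprime (\<Union>D)" "\<And>p. p \<in> \<Union>D \<Longrightarrow> coprime q p"
    and gt_1: "\<And>p. p \<in> \<Union>D \<Longrightarrow> 1 < p"
  shows "real (card (sifted {t. t < Y \<and> [t = r] (mod q)} (\<Union>D) a)) \<le>
    real Y / real q / selberg_main_sum real D +
    (selberg_error_sum real D / selberg_main_sum real D)\<^sup>2"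
proof -
  interpret finite_downset D by fact
  interpret selberg_sieve D real
    using gt_1 by unfold_locales simp
  let ?A = "{t. t < Y \<and> [t = r] (mod q)}"
  have "\<bar>real (card {t \<in> ?A. \<forall>p\<in>F. [t = a p] (mod p)}) - real Y / real q / prod real F\<bar> \<le> 1"
    if F: "F \<subseteq> \<Union>D" for F
  proof -
    have "q \<notin> F" using F coprime(2) gt_1 by fastforce
    define b where "b = a(q := r)"
    have finF: "finite F" using F finite_Union by (rule finite_subset)
    have "\<bar>real (card {t. t < Y \<and> (\<forall>p\<in>insert q F. [t = b p] (mod p))}) -
        real Y / real (\<Prod>(insert q F))\<bar> \<le> 1"
    proof (rule card_simultaneous_residues_bounds)
      have "pairwise coprime F" using coprime(1) F by (rule pairwise_subset)
      then show "pairwise coprime (insert q F)"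
        using coprime(2) F by (simp add: pairwise_insert coprime_commute subset_eq)
      show "0 \<notin> insert q F" using \<open>q > 0\<close> F gt_1 by fastforce
    qed (use finF in simp)
    moreover have "{t. t < Y \<and> (\<forall>p\<in>insert q F. [t = b p] (mod p))} =
        {t \<in> ?A. \<forall>p\<in>F. [t = a p] (mod p)}"
      using \<open>q \<notin> F\<close> by (auto simp: b_def)
    ultimately show ?thesis using \<open>q \<notin> F\<close> finF by (simp add: divide_divide_eq_left)
  qed
  then have "real (card {t \<in> ?A. \<forall>p\<in>\<Union>D. \<not> [t = a p] (mod p)}) \<le>
      real Y / real q / selberg_main_sum real D + 1 * (selberg_error_sum real D / selberg_main_sum real D)\<^sup>2"
    by (intro selberg_upper_bound) auto
  then show ?thesis by (simp add: sifted_def)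
qed

lemma coprime_6_iff: "coprime d 6 \<longleftrightarrow> odd d \<and> \<not> 3 dvd d" for d :: nat
proof -
  have "coprime d 6 \<longleftrightarrow> coprime d 2 \<and> coprime d 3"
    using coprime_mult_right_iff[of d 2 3] by simp
  moreover have "coprime d 3 \<longleftrightarrow> \<not> 3 dvd d"
    using prime_imp_coprime[of 3 d] by (auto simp: coprime_commute coprime_absorb_left)
  ultimately show ?thesis by simp
qed

lemma prime_ge_5_iff_coprime_6:
  fixes p :: nat
  assumes "prime p"
  shows "5 \<le> p \<longleftrightarrow> coprime p 6"
proof -
  have "2 dvd p \<longleftrightarrow> p = 2" "3 dvd p \<longleftrightarrow> p = 3"
    using primes_dvd_imp_eq[of 2 p] primes_dvd_imp_eq[of 3 p] assms by auto
  moreover from this have "p \<noteq> 4" by auto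
  ultimately show ?thesis using prime_ge_2_nat[OF assms] by (auto simp: coprime_6_iff)
qed

lemma sifted_2_3_subset:
  "sifted A {2, 3} a \<subseteq> {t \<in> A. [t = 3 * (a 2 + 1) + 4 * (a 3 + 1)] (mod 6)} \<union>
    {t \<in> A. [t = 3 * (a 2 + 1) + 4 * (a 3 + 2)] (mod 6)}"
proof
  fix t assume t: "t \<in> sifted A {2, 3} a"
  have residue: "[t = 3 * (a 2 + 1) + 4 * (a 3 + i)] (mod 6)" if "[t = a 3 + i] (mod 3)" for i
  proof -
    have "t mod 2 \<noteq> a 2 mod 2" using t by (simp add: sifted_def Cong.cong_def)
    then have "[t = 3 * (a 2 + 1) + 4 * (a 3 + i)] (mod 2)"
      by (simp add: Cong.cong_def mod2_eq_if split: if_splits)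
    moreover have "3 * (a 2 + 1) + 4 * (a 3 + i) = a 3 + i + 3 * (a 2 + 1 + (a 3 + i))" by simp
    then have "[a 3 + i = 3 * (a 2 + 1) + 4 * (a 3 + i)] (mod 3)"
      unfolding Cong.cong_def by (simp only: mod_mult_self2)
    then have "[t = 3 * (a 2 + 1) + 4 * (a 3 + i)] (mod 3)" by (rule cong_trans[OF that])
    ultimately have "[t = 3 * (a 2 + 1) + 4 * (a 3 + i)] (mod 2 * 3)"
      by (intro coprime_cong_mult_nat) auto
    then show ?thesis by simp
  qed
  have "t mod 3 \<noteq> a 3 mod 3" using t by (simp add: sifted_def Cong.cong_def)
  then have "[t = a 3 + 1] (mod 3) \<or> [t = a 3 + 2] (mod 3)"
    by (simp add: Cong.cong_def mod_Suc numeral_2_eq_2) linarith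
  moreover have "t \<in> A" using t sifted_subset by blast
  ultimately show "t \<in> {t \<in> A. [t = 3 * (a 2 + 1) + 4 * (a 3 + 1)] (mod 6)} \<union>
      {t \<in> A. [t = 3 * (a 2 + 1) + 4 * (a 3 + 2)] (mod 6)}"
    using residue by blast
qed

lemma card_sifted_2_3_le:
  fixes D :: "nat set set" and a :: "nat \<Rightarrow> nat" and Y :: nat
  assumes D: "finite_downset D" and primes: "\<And>p. p \<in> \<Union>D \<Longrightarrow> prime p \<and> 5 \<le> p"
  shows "real (card (sifted {..<Y} ({2, 3} \<union> \<Union>D) a)) \<le>
    real Y / (3 * selberg_main_sum real D) +
    2 * (selberg_error_sum real D / selberg_main_sum real D)\<^sup>2"
proof -
  let ?S = "\<lambda>r. sifted {t. t < Y \<and> [t = r] (mod 6)} (\<Union>D) a"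
  let ?B = "real Y / 6 / selberg_main_sum real D +
    (selberg_error_sum real D / selberg_main_sum real D)\<^sup>2"
  have card_S: "real (card (?S r)) \<le> ?B" for r
  proof -
    have "real (card (?S r)) \<le> real Y / real 6 / selberg_main_sum real D
        + (selberg_error_sum real D / selberg_main_sum real D)\<^sup>2"
    proof (rule card_sifted_progression_le[OF D])
      show "pairwise coprime (\<Union>D)"
        using primes by (auto intro!: pairwiseI primes_coprime)
      show "coprime 6 p" if "p \<in> \<Union>D" for p
        using primes[OF that] prime_ge_5_iff_coprime_6[of p] by (simp add: coprime_commute)
    qed (use primes in \<open>force+\<close>)
    then show ?thesis by simp
  qed
  obtain r s where "sifted {..<Y} {2, 3} a \<subseteq>
      {t \<in> {..<Y}. [t = r] (mod 6)} \<union> {t \<in> {..<Y}. [t = s] (mod 6)}"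
    using sifted_2_3_subset by blast
  then have "sifted {..<Y} ({2, 3} \<union> \<Union>D) a \<subseteq> ?S r \<union> ?S s"
    by (auto simp: sifted_def)
  then have "card (sifted {..<Y} ({2, 3} \<union> \<Union>D) a) \<le> card (?S r \<union> ?S s)"
    by (intro card_mono) (auto intro: finite_sifted)
  also have "\<dots> \<le> card (?S r) + card (?S s)" by (rule card_Un_le)
  finally have "real (card (sifted {..<Y} ({2, 3} \<union> \<Union>D) a)) \<le>
      real (card (?S r)) + real (card (?S s))"
    by linarith
  also have "\<dots> \<le> 2 * ?B" using add_mono[OF card_S card_S] by (simp only: mult_2)
  finally show ?thesis by simp
qed

lemma card_sifted_2_3_singletons_le:
  fixes P :: "nat set" and a :: "nat \<Rightarrow> nat" and Y :: nat
  assumes "finite P" and primes: "\<And>p. p \<in> P \<Longrightarrow> prime p \<and> 5 \<le> p"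
  defines "L \<equiv> 1 + (\<Sum>p\<in>P. 1 / (real p - 1))"
    and "R \<equiv> 1 + (\<Sum>p\<in>P. (real p + 1) / (real p - 1))"
  shows "real (card (sifted {..<Y} ({2, 3} \<union> P) a)) \<le> real Y / (3 * L) + 2 * (R / L)\<^sup>2"
proof -
  define D where "D = insert {} ((\<lambda>p. {p}) ` P)"
  have "\<Union>D = P" by (auto simp: D_def)
  have "finite_downset D"
    using assms(1) by unfold_locales (auto simp: D_def subset_singleton_iff)
  moreover have "(\<Sum>E\<in>D. prod f E) = 1 + sum f P" for f :: "nat \<Rightarrow> real"
    unfolding D_def using assms(1) by (subst sum.insert) (auto simp: sum.reindex)
  ultimately show ?thesis
    using card_sifted_2_3_le[of D Y a] primes \<open>\<Union>D = P\<close>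
    by (simp add: L_def R_def selberg_main_sum_def selberg_error_sum_def)
qed

section \<open>Sums over the integers coprime to 6\<close>

definition nth_coprime6 :: "nat \<Rightarrow> nat" where
  "nth_coprime6 n = 3 * n + 1 + n mod 2"

definition coprime6_upto :: "nat \<Rightarrow> nat set" where
  "coprime6_upto z = {d. d \<le> z \<and> coprime d 6}"

lemma nth_coprime6_bounds: "3 * n + 1 \<le> nth_coprime6 n" "nth_coprime6 n \<le> 3 * n + 2"
  unfolding nth_coprime6_def by simp_all

lemma strict_mono_nth_coprime6: "strict_mono nth_coprime6"
  unfolding strict_mono_Suc_iff nth_coprime6_def by (simp add: mod_Suc)

lemma range_nth_coprime6: "range nth_coprime6 = {d :: nat. coprime d 6}"
proof (intro equalityI subsetI)
  fix d :: nat assume "d \<in> {d. coprime d 6}"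
  then have "odd d" "d mod 3 \<noteq> 0" by (simp_all add: coprime_6_iff dvd_eq_mod_eq_0)
  moreover from this have "d = 3 * (d div 3) + 1 \<or> d = 3 * (d div 3) + 2"
    using div_mult_mod_eq[of d 3] by linarith
  then obtain n where "d = 3 * n + 1 \<or> d = 3 * n + 2" by blast
  ultimately have "d = nth_coprime6 n" by (auto simp: nth_coprime6_def mod2_eq_if)
  then show "d \<in> range nth_coprime6" by blast
next
  fix d assume "d \<in> range nth_coprime6"
  then obtain n where "d = 3 * n + 1 + n mod 2" by (auto simp: nth_coprime6_def)
  then have "odd d" "d mod 3 \<noteq> 0" by (auto simp: mod2_eq_if mod_Suc)
  then show "d \<in> {d. coprime d 6}" by (simp add: coprime_6_iff dvd_eq_mod_eq_0)
qed

lemma coprime6_upto_image: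
  obtains N where "coprime6_upto z = nth_coprime6 ` {..<N}" "z < nth_coprime6 N"
proof
  define N where "N = (LEAST n. z < nth_coprime6 n)"
  have "z < nth_coprime6 z" using nth_coprime6_bounds(1)[of z] by simp
  then show "z < nth_coprime6 N" unfolding N_def by (rule LeastI)
  have "nth_coprime6 n \<le> z \<longleftrightarrow> n < N" for n
  proof
    assume "nth_coprime6 n \<le> z"
    also note \<open>z < nth_coprime6 N\<close>
    finally show "n < N" by (simp add: strict_mono_less[OF strict_mono_nth_coprime6])
  next
    assume "n < N"
    then show "nth_coprime6 n \<le> z" unfolding N_def by (meson leI not_less_Least)
  qed
  then show "coprime6_upto z = nth_coprime6 ` {..<N}"
    unfolding coprime6_upto_def using range_nth_coprime6 by (auto 4 3 simp: set_eq_iff image_iff)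
qed

lemma finite_coprime6_upto: "finite (coprime6_upto z)"
  by (rule finite_subset[of _ "{..z}"]) (auto simp: coprime6_upto_def)

lemma coprime6_upto_pos: "d \<in> coprime6_upto z \<Longrightarrow> 0 < d"
  by (rule gr0I) (simp add: coprime6_upto_def)

lemma inj_on_nth_coprime6: "inj_on nth_coprime6 A"
  by (rule strict_mono_imp_inj_on[OF strict_mono_nth_coprime6])

lemma card_coprime6_upto_le: "real (card (coprime6_upto z)) \<le> (real z + 2) / 3"
proof -
  obtain N where N: "coprime6_upto z = nth_coprime6 ` {..<N}" by (rule coprime6_upto_image)
  then have "card (coprime6_upto z) = N" by (simp add: card_image inj_on_nth_coprime6)
  moreover have "3 * N \<le> z + 2"
  proof (cases N)
    case (Suc n)
    then have "nth_coprime6 n \<in> coprime6_upto z" using N by simp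
    then show ?thesis using nth_coprime6_bounds(1)[of n] Suc by (simp add: coprime6_upto_def)
  qed simp
  then have "3 * real N \<le> real z + 2" by linarith
  ultimately show ?thesis by simp
qed

lemma inverse_sqrt_le_diff_sqrt:
  fixes x :: real
  assumes "0 \<le> x" "0 < h"
  shows "1 / sqrt (x + h) \<le> 2 / h * (sqrt (x + h) - sqrt x)"
proof -
  have pos: "0 < sqrt (x + h)" and mono: "sqrt x \<le> sqrt (x + h)" using assms by simp_all
  have "h = (sqrt (x + h) - sqrt x) * (sqrt (x + h) + sqrt x)"
    using assms by (simp add: algebra_simps)
  also have "\<dots> \<le> (sqrt (x + h) - sqrt x) * (2 * sqrt (x + h))"
    using mono by (intro mult_left_mono) auto
  finally show ?thesis using pos assms(2) by (simp add: field_simps)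
qed

lemma sum_inverse_sqrt_nth_coprime6_le:
  "(\<Sum>i<Suc n. 1 / sqrt (real (nth_coprime6 i))) \<le> 2 / 3 * sqrt (3 * real n + 1) + 1 / 3"
proof (induction n)
  case 0
  show ?case by (simp add: nth_coprime6_def)
next
  case (Suc n)
  have "1 / sqrt (real (nth_coprime6 (Suc n))) \<le> 1 / sqrt (3 * real n + 1 + 3)"
    using nth_coprime6_bounds(1)[of "Suc n"] by (intro divide_left_mono) auto
  also have "\<dots> \<le> 2 / 3 * (sqrt (3 * real n + 1 + 3) - sqrt (3 * real n + 1))"
    by (intro inverse_sqrt_le_diff_sqrt) simp_all
  finally show ?case using Suc by (simp add: algebra_simps)
qed

lemma sum_inverse_sqrt_coprime6_upto_le:
  "(\<Sum>d\<in>coprime6_upto z. 1 / sqrt (real d)) \<le> 2 / 3 * sqrt (real z) + 1 / 3"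
proof -
  obtain N where N: "coprime6_upto z = nth_coprime6 ` {..<N}" by (rule coprime6_upto_image)
  then have sum: "(\<Sum>d\<in>coprime6_upto z. 1 / sqrt (real d)) =
      (\<Sum>i<N. 1 / sqrt (real (nth_coprime6 i)))"
    by (simp add: sum.reindex inj_on_nth_coprime6)
  show ?thesis
  proof (cases N)
    case (Suc n)
    then have "nth_coprime6 n \<in> coprime6_upto z" using N by simp
    then have "3 * n + 1 \<le> z" using nth_coprime6_bounds(1)[of n] by (simp add: coprime6_upto_def)
    then have "3 * real n + 1 \<le> real z" by linarith
    then have "sqrt (3 * real n + 1) \<le> sqrt (real z)" by simp
    then show ?thesis unfolding sum Suc using sum_inverse_sqrt_nth_coprime6_le[of n] by linarith
  qed (simp add: sum)
qed

lemma ln_le_tangent_power_2: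
  fixes y :: real
  assumes "0 < y"
  shows "ln y \<le> y / 2 ^ t + (25 / 36 * real t - 1)"
proof -
  have "ln (y / 2 ^ t) \<le> y / 2 ^ t - 1" using assms by (intro ln_le_minus_one) simp
  then have "ln y \<le> y / 2 ^ t - 1 + real t * ln 2"
    using assms by (simp add: ln_divide_pos ln_realpow)
  also have "real t * ln 2 \<le> real t * (25 / 36)"
    using ln2_le_25_over_36 by (intro mult_left_mono) auto
  finally show ?thesis by simp
qed

lemma sum_inverse_nth_coprime6_ge:
  assumes "11 \<le> n"
  shows "ln (3 * (3 * real n + 2)) + 3 / 5 \<le> 3 * (\<Sum>i<n. 1 / real (nth_coprime6 i))"
  using assms
proof (induction n rule: dec_induct)
  case base
  have "ln 105 + 3 / 5 \<le> 105 / 2 ^ 7 + (25 / 36 * real 7 - 1) + (3 / 5 :: real)"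
    by (intro add_right_mono ln_le_tangent_power_2) simp
  also have "\<dots> \<le> 3 * (1 + 1/5 + 1/7 + 1/11 + 1/13 + 1/17 + 1/19 + 1/23 + 1/25 + 1/29 + 1/31)"
    by simp
  also have "\<dots> = 3 * (\<Sum>i<11. 1 / real (nth_coprime6 i))"
    by (simp add: nth_coprime6_def lessThan_nat_numeral lessThan_Suc)
  finally show ?case by simp
next
  case (step n)
  have "ln (3 * (3 * real (Suc n) + 2)) = ln (3 * (3 * real n + 2)) + ln (1 + 3 / (3 * real n + 2))"
    by (subst ln_mult_pos[symmetric]) (auto simp: field_simps add_pos_nonneg)
  also have "ln (1 + 3 / (3 * real n + 2)) \<le> 3 / (3 * real n + 2)"
    by (intro ln_add_one_self_le_self) simp
  also have "\<dots> \<le> 3 / real (nth_coprime6 n)"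
    using nth_coprime6_bounds[of n] by (intro divide_left_mono) auto
  finally show ?case using step.IH by simp
qed

lemma sum_inverse_coprime6_upto_ge:
  assumes "31 \<le> z"
  shows "ln (3 * (real z + 1)) + 3 / 5 \<le> 3 * (\<Sum>d\<in>coprime6_upto z. 1 / real d)"
proof -
  obtain N where N: "coprime6_upto z = nth_coprime6 ` {..<N}" "z < nth_coprime6 N"
    by (rule coprime6_upto_image)
  have z: "z < 3 * N + 2" using N(2) nth_coprime6_bounds(2)[of N] by linarith
  have "11 \<le> N"
  proof (rule ccontr)
    assume "\<not> 11 \<le> N"
    then have "nth_coprime6 N \<le> nth_coprime6 10"
      by (intro monoD[OF strict_mono_mono[OF strict_mono_nth_coprime6]]) simp
    then show False using N(2) assms by (simp add: nth_coprime6_def)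
  qed
  have "ln (3 * (real z + 1)) \<le> ln (3 * (3 * real N + 2))" using z by simp
  then have "ln (3 * (real z + 1)) + 3 / 5 \<le> 3 * (\<Sum>i<N. 1 / real (nth_coprime6 i))"
    using sum_inverse_nth_coprime6_ge[OF \<open>11 \<le> N\<close>] by linarith
  then show ?thesis by (simp add: N(1) sum.reindex inj_on_nth_coprime6)
qed

section \<open>Sums over sets of primes with bounded product\<close>

definition prime_sets_upto :: "nat \<Rightarrow> nat set set" where
  "prime_sets_upto z = {E. finite E \<and> (\<forall>p\<in>E. prime p \<and> 5 \<le> p) \<and> \<Prod>E \<le> z}"

lemma prime_sets_uptoD:
  assumes "E \<in> prime_sets_upto z"
  shows "finite E" "\<And>p. p \<in> E \<Longrightarrow> prime p" "\<And>p. p \<in> E \<Longrightarrow> 5 \<le> p" "\<Prod>E \<le> z" "0 < \<Prod>E"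
  using assms unfolding prime_sets_upto_def by (auto intro!: prod_pos simp: prime_gt_0_nat)

lemma prime_sets_upto_memD:
  assumes "p \<in> \<Union>(prime_sets_upto z)"
  shows "prime p" "5 \<le> p" "p \<le> z"
proof -
  obtain E where E: "E \<in> prime_sets_upto z" "p \<in> E" using assms by blast
  note E_upto = prime_sets_uptoD[OF E(1)]
  show "prime p" "5 \<le> p" using E_upto E(2) by blast+
  have "p dvd \<Prod>E" using E_upto(1) E(2) by (rule dvd_prodI)
  then show "p \<le> z" using E_upto(4,5) by (meson dvd_imp_le le_trans)
qed

lemma finite_downset_prime_sets_upto:
  assumes "1 \<le> z"
  shows "finite_downset (prime_sets_upto z)"
proof
  have "\<Union>(prime_sets_upto z) \<subseteq> {..z}" using prime_sets_upto_memD(3) by (intro subsetI) simp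
  then show "finite (\<Union>(prime_sets_upto z))" by (rule finite_subset) simp
  show "{} \<in> prime_sets_upto z" using assms by (simp add: prime_sets_upto_def)
  fix E F assume F: "F \<in> prime_sets_upto z" and "E \<subseteq> F"
  note F_upto = prime_sets_uptoD[OF F]
  have "\<Prod>E dvd \<Prod>F" using F_upto(1) \<open>E \<subseteq> F\<close> by (rule prod_dvd_prod_subset)
  then have "\<Prod>E \<le> \<Prod>F" using F_upto(5) by (rule dvd_imp_le)
  moreover have "finite E" using \<open>E \<subseteq> F\<close> F_upto(1) by (rule finite_subset)
  ultimately show "E \<in> prime_sets_upto z"
    using F_upto(2-4) \<open>E \<subseteq> F\<close> by (auto simp: prime_sets_upto_def)
qed

lemma selberg_sieve_prime_sets_upto:
  assumes "1 \<le> z"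
  shows "selberg_sieve (prime_sets_upto z) real"
proof -
  interpret finite_downset "prime_sets_upto z"
    using assms by (rule finite_downset_prime_sets_upto)
  show ?thesis by unfold_locales (use prime_sets_upto_memD(2) in fastforce)
qed

lemma prime_factors_Prod_primes:
  fixes E :: "nat set"
  assumes "finite E" "\<And>p. p \<in> E \<Longrightarrow> prime p"
  shows "prime_factors (\<Prod>E) = E"
proof -
  have "0 \<notin> (\<lambda>p. p) ` E" using assms(2) not_prime_0 by force
  then have "prime_factors (\<Prod>E) = (\<Union>p\<in>E. prime_factors p)"
    using assms(1) by (subst prime_factors_prod) simp_all
  then show ?thesis using assms(2) by (simp add: prime_prime_factors)
qed

lemma inj_on_Prod_prime_sets_upto: "inj_on (\<lambda>E. \<Prod>E) (prime_sets_upto z)"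
proof (rule inj_on_inverseI)
  show "prime_factors (\<Prod>E) = E" if "E \<in> prime_sets_upto z" for E
    using prime_sets_uptoD(1,2)[OF that] by (rule prime_factors_Prod_primes)
qed

lemma Prod_in_coprime6_upto:
  assumes "E \<in> prime_sets_upto z"
  shows "\<Prod>E \<in> coprime6_upto z"
proof -
  note E = prime_sets_uptoD[OF assms]
  have "coprime (\<Prod>E) 6"
    using E(2,3) by (intro prod_coprime_left) (simp flip: prime_ge_5_iff_coprime_6)
  then show ?thesis using E(4) by (simp add: coprime6_upto_def)
qed

lemma prime_factors_in_prime_sets_upto:
  assumes "d \<in> coprime6_upto z"
  shows "prime_factors d \<in> prime_sets_upto z"
proof -
  have d: "d \<le> z" "coprime d 6" using assms by (simp_all add: coprime6_upto_def)
  have "d > 0" using assms by (rule coprime6_upto_pos)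
  have "5 \<le> p" if "p \<in> prime_factors d" for p
    using that d(2) prime_ge_5_iff_coprime_6[of p] by (auto intro: coprime_divisors[OF _ dvd_refl])
  moreover have "\<Prod>(prime_factors d) \<le> z"
  proof -
    have "\<Prod>(prime_factors d) dvd (\<Prod>p\<in>prime_factors d. p ^ multiplicity p d)"
      by (intro prod_dvd_prod) (auto simp: prime_factors_multiplicity dvd_power)
    then have "\<Prod>(prime_factors d) dvd d" using \<open>d > 0\<close> prime_factorization_nat[of d] by simp
    then show ?thesis using \<open>d > 0\<close> d(1) by (meson dvd_imp_le le_trans)
  qed
  ultimately show ?thesis by (auto simp: prime_sets_upto_def)
qed

lemma sum_power_inverse_le:
  fixes x :: real
  assumes "1 < x"
  shows "(\<Sum>k=1..K. (1 / x) ^ k) \<le> 1 / (x - 1)"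
proof -
  have "(\<Sum>k=1..K. (1 / x) ^ k) = 1 / x * (\<Sum>k<K. (1 / x) ^ k)"
    by (simp add: sum.atLeast1_atMost_eq sum_distrib_left)
  also have "\<dots> \<le> 1 / x * (1 / (1 - 1 / x))"
    using assms by (intro mult_left_mono less_imp_le geometric_sum_less) auto
  also have "\<dots> = 1 / (x - 1)" using assms by (simp add: field_simps)
  finally show ?thesis .
qed

lemma sum_prod_power_inverse_le:
  fixes x :: "'a \<Rightarrow> real" and H :: "('a \<Rightarrow> nat) set"
  assumes E: "finite E" "\<And>p. p \<in> E \<Longrightarrow> 1 < x p"
    and H: "finite H" "H \<subseteq> PiE E (\<lambda>_. {1..})"
  shows "(\<Sum>h\<in>H. \<Prod>p\<in>E. (1 / x p) ^ h p) \<le> (\<Prod>p\<in>E. 1 / (x p - 1))"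
proof -
  have nonneg: "0 \<le> 1 / x p" if "p \<in> E" for p using E(2)[OF that] by simp
  have "finite (\<Union>h\<in>H. h ` E)" using E(1) H(1) by simp
  then obtain K where K: "\<forall>k\<in>(\<Union>h\<in>H. h ` E). k \<le> K"
    unfolding finite_nat_set_iff_bounded_le by blast
  have "h \<in> PiE E (\<lambda>_. {1..K})" if "h \<in> H" for h
    using H(2) K that by (auto simp: PiE_iff subset_eq)
  then have "(\<Sum>h\<in>H. \<Prod>p\<in>E. (1 / x p) ^ h p) \<le> (\<Sum>h\<in>PiE E (\<lambda>_. {1..K}). \<Prod>p\<in>E. (1 / x p) ^ h p)"
    using E(1) nonneg by (intro sum_mono2 finite_PiE prod_nonneg zero_le_power) auto
  also have "\<dots> = (\<Prod>p\<in>E. \<Sum>k=1..K. (1 / x p) ^ k)"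
    using E(1) by (intro prod_sum_PiE[symmetric]) auto
  also have "\<dots> \<le> (\<Prod>p\<in>E. 1 / (x p - 1))"
    using E(2) nonneg by (intro prod_mono conjI sum_power_inverse_le sum_nonneg zero_le_power)
  finally show ?thesis .
qed

lemma sum_inverse_fixed_prime_factors_le:
  fixes M E :: "nat set"
  assumes M: "finite M" "\<And>d. d \<in> M \<Longrightarrow> d > 0 \<and> prime_factors d = E"
    and E: "finite E" "\<And>p. p \<in> E \<Longrightarrow> prime p"
  shows "(\<Sum>d\<in>M. 1 / real d) \<le> (\<Prod>p\<in>E. 1 / (real p - 1))"
proof -
  define exponents where "exponents d = restrict (\<lambda>p. multiplicity p d) E" for d :: nat
  have factorization: "d = (\<Prod>p\<in>E. p ^ exponents d p)" if "d \<in> M" for d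
    using M(2)[OF that] prime_factorization_nat[of d] by (simp add: exponents_def)
  then have "1 / real d = (\<Prod>p\<in>E. (1 / real p) ^ exponents d p)" if "d \<in> M" for d
    using arg_cong[OF factorization[OF that], of real] by (simp add: prod_dividef power_divide)
  then have "(\<Sum>d\<in>M. 1 / real d) = (\<Sum>d\<in>M. \<Prod>p\<in>E. (1 / real p) ^ exponents d p)"
    by (rule sum.cong[OF refl])
  also have "\<dots> = (\<Sum>h\<in>exponents ` M. \<Prod>p\<in>E. (1 / real p) ^ h p)"
  proof -
    have "inj_on exponents M" by (rule inj_onI) (metis factorization)
    then show ?thesis by (simp add: sum.reindex)
  qed
  also have "\<dots> \<le> (\<Prod>p\<in>E. 1 / (real p - 1))"
  proof (rule sum_prod_power_inverse_le)
    have "1 \<le> multiplicity p d" if "d \<in> M" "p \<in> E" for d p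
    proof -
      have "p \<in> prime_factors d" using M(2)[OF \<open>d \<in> M\<close>] \<open>p \<in> E\<close> by simp
      then show ?thesis by (simp add: prime_factors_multiplicity Suc_le_eq)
    qed
    then show "exponents ` M \<subseteq> PiE E (\<lambda>_. {1..})"
      by (intro image_subsetI) (simp add: exponents_def PiE_iff)
    show "1 < real p" if "p \<in> E" for p using prime_gt_1_nat[OF E(2)[OF that]] by simp
  qed (use M(1) E(1) in simp_all)
  finally show ?thesis .
qed

lemma selberg_main_sum_prime_sets_upto_ge:
  assumes "1 \<le> z"
  shows "(\<Sum>d\<in>coprime6_upto z. 1 / real d) \<le> selberg_main_sum real (prime_sets_upto z)"
proof -
  interpret finite_downset "prime_sets_upto z"
    using assms by (rule finite_downset_prime_sets_upto)
  have "(\<Sum>d\<in>coprime6_upto z. 1 / real d) =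
      (\<Sum>E\<in>prime_sets_upto z. \<Sum>d | d \<in> coprime6_upto z \<and> prime_factors d = E. 1 / real d)"
    using prime_factors_in_prime_sets_upto
    by (intro sum.group[symmetric] finite_coprime6_upto finite_family) blast
  also have "\<dots> \<le> selberg_main_sum real (prime_sets_upto z)"
    unfolding selberg_main_sum_def
  proof (intro sum_mono sum_inverse_fixed_prime_factors_le)
    show "d > 0 \<and> prime_factors d = E"
      if "d \<in> {d. d \<in> coprime6_upto z \<and> prime_factors d = E}" for E d
      using that coprime6_upto_pos by blast
  qed (auto dest: prime_sets_uptoD finite_mem simp: finite_coprime6_upto)
  finally show ?thesis .
qed

lemma prod_two_div_mult_pred_plus_one_le:
  fixes P :: "nat set"
  assumes "finite P" "\<And>p. p \<in> P \<Longrightarrow> odd p \<and> 5 \<le> p"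
  shows "(\<Prod>p\<in>P. 2 / (real p * (real p - 1)) + 1) \<le> 4 / 3"
proof -
  define f where "f p = 2 / (real p * (real p - 1)) + 1" for p :: nat
  define g where "g i = (2 * real i + 4) / (2 * real i + 3)" for i
  have g_pos: "g i > 0" for i by (simp add: g_def add_nonneg_pos)
  have f_le: "f (2 * i + 5) \<le> g i / g (Suc i)" for i
  proof -
    have "(2 * real i + 3) * (2 * real i + 6) \<le> (2 * real i + 5) * (2 * real i + 4)"
      by (simp add: algebra_simps)
    then have "2 / ((2 * real i + 5) * (2 * real i + 4)) \<le> 2 / ((2 * real i + 3) * (2 * real i + 6))"
      by (intro divide_left_mono mult_pos_pos add_nonneg_pos) auto
    moreover have "g i / g (Suc i) = 2 / ((2 * real i + 3) * (2 * real i + 6)) + 1"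
      unfolding g_def by (simp add: divide_simps add_nonneg_eq_0_iff) (simp add: algebra_simps)
    ultimately show ?thesis by (simp add: f_def add_ac)
  qed
  define K where "K = Suc (Max P)"
  have "P \<subseteq> (\<lambda>i. 2 * i + 5) ` {..<K}"
  proof
    fix p assume "p \<in> P"
    then have "odd p" "5 \<le> p" "p < K" using assms by (auto simp: K_def less_Suc_eq_le)
    then have "p = 2 * ((p - 5) div 2) + 5" "(p - 5) div 2 < K" by presburger+
    then show "p \<in> (\<lambda>i. 2 * i + 5) ` {..<K}" by blast
  qed
  then have "prod f P \<le> prod f ((\<lambda>i. 2 * i + 5) ` {..<K})"
    by (intro prod_mono2) (auto simp: f_def)
  also have "\<dots> = (\<Prod>i<K. f (2 * i + 5))"
    by (subst prod.reindex) (auto simp: inj_on_def)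
  also have "\<dots> \<le> (\<Prod>i<K. g i / g (Suc i))"
    using f_le by (intro prod_mono) (auto simp: f_def)
  also have "\<dots> = g 0 / g K"
    using g_pos by (intro prod_lessThan_telescope') (auto simp: less_imp_neq[symmetric])
  also have "\<dots> \<le> 4 / 3"
    by (simp add: g_def field_simps)
  finally show ?thesis by (simp add: f_def)
qed

lemma sqrt_Prod: "sqrt (real (\<Prod>E)) = (\<Prod>p\<in>E. sqrt (real p))"
  by (induction E rule: infinite_finite_induct) (simp_all add: real_sqrt_mult)

lemma two_div_pred_le_inverse_sqrt:
  fixes x :: real
  assumes "7 \<le> x"
  shows "2 / (x - 1) \<le> 1 / sqrt x"
proof -
  have "7 * x \<le> x * x" using assms by (intro mult_right_mono) auto
  moreover have "(x - 1)\<^sup>2 = x * x - 2 * x + 1" by (simp add: power2_eq_square algebra_simps)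
  ultimately have "4 * x \<le> (x - 1)\<^sup>2" using assms by linarith
  then have "sqrt (4 * x) \<le> x - 1" using assms by (intro real_le_lsqrt) auto
  then show ?thesis using assms by (simp add: real_sqrt_mult field_simps)
qed

lemma prod_two_div_pred_le:
  fixes E :: "nat set"
  assumes "finite E" "\<And>p. p \<in> E \<Longrightarrow> p = 5 \<or> 7 \<le> p"
  shows "(\<Prod>p\<in>E. 2 / (real p - 1)) \<le> 9 / 8 * (1 / sqrt (real (\<Prod>E)))"
proof -
  let ?c = "\<lambda>p :: nat. if p = 5 then 9 / 8 else 1 :: real"
  have "(\<Prod>p\<in>E. 2 / (real p - 1)) \<le> (\<Prod>p\<in>E. ?c p * (1 / sqrt (real p)))"
  proof (intro prod_mono conjI)
    fix p assume "p \<in> E"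
    then have p: "p = 5 \<or> 7 \<le> p" by (rule assms(2))
    then show "0 \<le> 2 / (real p - 1)" by auto
    have "sqrt 5 \<le> (9 / 4 :: real)" by (intro real_le_lsqrt) (auto simp: power2_eq_square)
    then have "1 / 2 \<le> 9 / 8 * (1 / sqrt 5 :: real)" by (simp add: field_simps)
    then show "2 / (real p - 1) \<le> ?c p * (1 / sqrt (real p))"
      using p two_div_pred_le_inverse_sqrt[of "real p"] by auto
  qed
  also have "\<dots> = (if 5 \<in> E then 9 / 8 else 1) * (1 / sqrt (real (\<Prod>E)))"
    using assms(1) by (simp only: prod.distrib prod.delta prod_dividef sqrt_Prod) simp
  also have "\<dots> \<le> 9 / 8 * (1 / sqrt (real (\<Prod>E)))"
    by (intro mult_right_mono divide_nonneg_nonneg real_sqrt_ge_zero of_nat_0_le_iff) auto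
  finally show ?thesis .
qed

lemma card_prime_supersets_le:
  assumes F: "F \<in> prime_sets_upto z"
  shows "real (card {E \<in> prime_sets_upto z. F \<subseteq> E}) \<le> (real z / real (\<Prod>F) + 2) / 3"
proof -
  note F_upto = prime_sets_uptoD[OF F]
  let ?S = "{E \<in> prime_sets_upto z. F \<subseteq> E}" and ?y = "z div \<Prod>F"
  have diff_mem: "E - F \<in> prime_sets_upto ?y" if "E \<in> ?S" for E
  proof -
    have E: "E \<in> prime_sets_upto z" "F \<subseteq> E" using that by auto
    note E_upto = prime_sets_uptoD[OF E(1)]
    have "\<Prod>(E - F) * \<Prod>F \<le> z"
      using prod.subset_diff[OF E(2) E_upto(1), of "\<lambda>p. p"] E_upto(4) by simp
    then have "\<Prod>(E - F) \<le> ?y" using F_upto(5) by (simp add: less_eq_div_iff_mult_less_eq)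
    then show ?thesis using E_upto(1-3) by (simp add: prime_sets_upto_def)
  qed
  have "inj_on (\<lambda>E. E - F) ?S" by (rule inj_onI) blast
  moreover have "inj_on (\<lambda>E. \<Prod>E) ((\<lambda>E. E - F) ` ?S)"
    using inj_on_Prod_prime_sets_upto by (rule inj_on_subset) (use diff_mem in blast)
  ultimately have "inj_on (\<lambda>E. \<Prod>(E - F)) ?S"
    using comp_inj_on[of "\<lambda>E. E - F" ?S "\<lambda>E. \<Prod>E"] by (simp add: o_def)
  then have "card ?S \<le> card (coprime6_upto ?y)"
    using diff_mem Prod_in_coprime6_upto finite_coprime6_upto by (intro card_inj_on_le) auto
  then have "real (card ?S) \<le> (real ?y + 2) / 3"
    using card_coprime6_upto_le[of ?y] by linarith
  also have "real ?y \<le> real z / real (\<Prod>F)" by (rule of_nat_div_le_of_nat)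
  finally show ?thesis by simp
qed

lemma sum_prod_two_div_pred_div_Prod_le:
  assumes "1 \<le> z"
  shows "(\<Sum>F\<in>prime_sets_upto z. (\<Prod>p\<in>F. 2 / (real p - 1)) / real (\<Prod>F)) \<le> 4 / 3"
proof -
  interpret finite_downset "prime_sets_upto z"
    using assms by (rule finite_downset_prime_sets_upto)
  have "(\<Sum>F\<in>prime_sets_upto z. (\<Prod>p\<in>F. 2 / (real p - 1)) / real (\<Prod>F)) =
      (\<Sum>F\<in>prime_sets_upto z. \<Prod>p\<in>F. 2 / (real p * (real p - 1)))"
    by (simp add: mult.commute flip: prod_dividef)
  also have "\<dots> \<le> (\<Prod>p\<in>\<Union>(prime_sets_upto z). 2 / (real p * (real p - 1)) + 1)"
    using prime_sets_upto_memD(2) by (intro sum_prod_le_prod_add_one) fastforce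
  also have "\<dots> \<le> 4 / 3"
  proof (rule prod_two_div_mult_pred_plus_one_le[OF finite_Union])
    fix p assume "p \<in> \<Union>(prime_sets_upto z)"
    then have "prime p" "5 \<le> p" by (rule prime_sets_upto_memD)+
    then show "odd p \<and> 5 \<le> p" using prime_odd_nat[of p] by simp
  qed
  finally show ?thesis .
qed

lemma sum_prod_two_div_pred_le:
  "(\<Sum>F\<in>prime_sets_upto z. \<Prod>p\<in>F. 2 / (real p - 1)) \<le> 3 / 4 * sqrt (real z) + 3 / 8"
proof -
  have "(\<Sum>F\<in>prime_sets_upto z. \<Prod>p\<in>F. 2 / (real p - 1)) \<le>
      (\<Sum>F\<in>prime_sets_upto z. 9 / 8 * (1 / sqrt (real (\<Prod>F))))"
  proof (intro sum_mono prod_two_div_pred_le)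
    fix F p assume F: "F \<in> prime_sets_upto z" and "p \<in> F"
    then have "prime p" "5 \<le> p" by (auto dest: prime_sets_uptoD)
    moreover from \<open>prime p\<close> have "p \<noteq> 6" using primes_dvd_imp_eq[of 2 p] by auto
    ultimately show "p = 5 \<or> 7 \<le> p" by linarith
  qed (rule prime_sets_uptoD)
  also have "\<dots> = 9 / 8 * (\<Sum>d\<in>(\<lambda>F. \<Prod>F) ` prime_sets_upto z. 1 / sqrt (real d))"
    by (simp only: sum_distrib_left sum.reindex[OF inj_on_Prod_prime_sets_upto] o_def)
  also have "\<dots> \<le> 9 / 8 * (\<Sum>d\<in>coprime6_upto z. 1 / sqrt (real d))"
    using Prod_in_coprime6_upto finite_coprime6_upto by (intro mult_left_mono sum_mono2) auto
  also have "\<dots> \<le> 9 / 8 * (2 / 3 * sqrt (real z) + 1 / 3)"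
    by (intro mult_left_mono sum_inverse_sqrt_coprime6_upto_le) simp
  finally show ?thesis by simp
qed

lemma selberg_error_sum_prime_sets_upto_le:
  assumes "31 \<le> z"
  shows "selberg_error_sum real (prime_sets_upto z) \<le> 6 / 11 * real z"
proof -
  interpret finite_downset "prime_sets_upto z"
    using assms by (intro finite_downset_prime_sets_upto) simp
  let ?D = "prime_sets_upto z" and ?w = "\<lambda>F. \<Prod>p\<in>F. 2 / (real p - 1)"
  have w_nonneg: "0 \<le> ?w F" if "F \<in> ?D" for F
    using prime_sets_uptoD(3)[OF that] by (intro prod_nonneg) force
  have "(real p + 1) / (real p - 1) = 2 / (real p - 1) + 1" if "p \<in> E" "E \<in> ?D" for p E
    using prime_sets_uptoD(3)[OF that(2,1)] by (simp add: field_simps)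
  then have "selberg_error_sum real ?D = (\<Sum>E\<in>?D. \<Prod>p\<in>E. 2 / (real p - 1) + 1)"
    unfolding selberg_error_sum_def by (intro sum.cong prod.cong refl) simp
  also have "\<dots> = (\<Sum>F\<in>?D. real (card {E \<in> ?D. F \<subseteq> E}) * ?w F)"
    by (rule sum_prod_add_one)
  also have "\<dots> \<le> (\<Sum>F\<in>?D. (real z / real (\<Prod>F) + 2) / 3 * ?w F)"
    by (intro sum_mono mult_right_mono card_prime_supersets_le w_nonneg)
  also have "\<dots> = real z / 3 * (\<Sum>F\<in>?D. ?w F / real (\<Prod>F)) + 2 / 3 * (\<Sum>F\<in>?D. ?w F)"
    unfolding sum_distrib_left sum.distrib[symmetric]
    by (intro sum.cong refl) (simp add: field_simps)
  also have "\<dots> \<le> real z / 3 * (4 / 3) + 2 / 3 * (3 / 4 * sqrt (real z) + 3 / 8)"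
    using assms
    by (intro add_mono mult_left_mono sum_prod_two_div_pred_div_Prod_le sum_prod_two_div_pred_le) auto
  also have "\<dots> \<le> 6 / 11 * real z"
  proof -
    have "(11 / 2)\<^sup>2 \<le> real z" using assms by (simp add: power_divide)
    then have "11 / 2 * sqrt (real z) \<le> sqrt (real z) * sqrt (real z)"
      by (intro mult_right_mono real_le_rsqrt) auto
    then have "11 / 2 * sqrt (real z) \<le> real z" by simp
    moreover have "31 \<le> real z" using assms by simp
    ultimately show ?thesis by (simp add: algebra_simps)
  qed
  finally show ?thesis .
qed

section \<open>Intervals sifted by all small primes\<close>

lemma convex_quadratic_neg_between:
  fixes a b c x y z :: real
  assumes "0 \<le> a" "x \<le> y" "y \<le> z"
    and neg: "a * x\<^sup>2 + b * x + c < 0" "a * z\<^sup>2 + b * z + c < 0"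
  shows "a * y\<^sup>2 + b * y + c < 0"
proof -
  define slope where "slope = a * (x + z) + b"
  define intercept where "intercept = c - a * x * z"
  have "0 \<le> a * ((y - x) * (z - y))" using assms by simp
  then have chord: "a * y\<^sup>2 + b * y + c \<le> slope * y + intercept"
    by (simp add: slope_def intercept_def power2_eq_square algebra_simps)
  have ends: "slope * x + intercept < 0" "slope * z + intercept < 0"
    using neg by (simp_all add: slope_def intercept_def power2_eq_square algebra_simps)
  show ?thesis
  proof (cases "0 \<le> slope")
    case True
    then have "slope * y \<le> slope * z" using assms by (intro mult_left_mono)
    then show ?thesis using chord ends by linarith
  next
    case False
    then have "slope * y \<le> slope * x" using assms by (intro mult_left_mono_neg) auto
    then show ?thesis using chord ends by linarith
  qed
qed

text \<open>Replacing \<open>ln y\<close> by its tangent at \<open>2 ^ t\<close> turns the claim into a convex quadratic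
  inequality, which only has to be checked at the ends of the interval.\<close>

lemma affine_less_divide_ln:
  fixes u v x y z :: real and t :: nat
  defines "c \<equiv> 25 / 36 * real t - 1"
  assumes "0 \<le> u" "0 \<le> v" "1 < x" "x \<le> y" "y \<le> z"
    and ends: "(u * x + v) * (x / 2 ^ t + c) < 2 * x" "(u * z + v) * (z / 2 ^ t + c) < 2 * z"
  shows "u * y + v < 2 * y / ln y"
proof -
  have quadratic: "u / 2 ^ t * s\<^sup>2 + (u * c + v / 2 ^ t - 2) * s + v * c < 0 \<longleftrightarrow>
      (u * s + v) * (s / 2 ^ t + c) < 2 * s" for s
    by (simp add: power2_eq_square algebra_simps add_divide_distrib)
  have "u / 2 ^ t * y\<^sup>2 + (u * c + v / 2 ^ t - 2) * y + v * c < 0"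
  proof (rule convex_quadratic_neg_between)
    show "0 \<le> u / 2 ^ t" using \<open>0 \<le> u\<close> by simp
    show "x \<le> y" "y \<le> z" by fact+
  qed (use ends in \<open>simp_all only: quadratic\<close>)
  then have "(u * y + v) * (y / 2 ^ t + c) < 2 * y" by (simp only: quadratic)
  moreover have "(u * y + v) * ln y \<le> (u * y + v) * (y / 2 ^ t + c)"
    unfolding c_def using assms by (intro mult_left_mono ln_le_tangent_power_2) auto
  ultimately have "(u * y + v) * ln y < 2 * y" by linarith
  then show ?thesis using assms by (simp add: pos_less_divide_eq)
qed

abbreviation sifted_primes :: "nat \<Rightarrow> (nat \<Rightarrow> nat) \<Rightarrow> nat set" where
  "sifted_primes Y a \<equiv> sifted {..<Y} {p. prime p \<and> p \<le> Y} a"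

lemma card_sifted_primes_le:
  assumes "P \<subseteq> {p. prime p \<and> p \<le> Y}"
  shows "card (sifted_primes Y a) \<le> card (sifted {..<Y} P a)"
  using assms by (intro card_mono finite_sifted sifted_antimono) auto

lemma card_sifted_primes_less_upto_300:
  fixes Y :: nat
  assumes "3 \<le> Y" "Y \<le> 300"
  shows "real (card (sifted_primes Y a)) < 2 * real Y / ln (real Y)"
proof -
  have "real (card (sifted_primes Y a)) \<le> real (card (sifted {..<Y} ({2, 3} \<union> {}) a))"
    using assms by (intro of_nat_mono card_sifted_primes_le) auto
  also have "\<dots> \<le> 1 / 3 * real Y + 2"
    using card_sifted_2_3_singletons_le[of "{}" Y a] by simp
  also have "\<dots> < 2 * real Y / ln (real Y)"
  proof (cases "Y \<le> 50")
    case True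
    then show ?thesis
      using assms by (intro affine_less_divide_ln[where x = 3 and z = 50 and t = 4]) simp_all
  next
    case False
    then show ?thesis
      using assms by (intro affine_less_divide_ln[where x = 50 and z = 300 and t = 8]) simp_all
  qed
  finally show ?thesis .
qed

lemma card_sifted_primes_less_upto_9000:
  fixes Y :: nat
  assumes "300 \<le> Y" "Y \<le> 9000"
  shows "real (card (sifted_primes Y a)) < 2 * real Y / ln (real Y)"
proof -
  define P where "P = {5, 7, 11, 13 :: nat}"
  have P: "prime p \<and> 5 \<le> p \<and> p \<le> 13" if "p \<in> P" for p
    using that by (auto simp: P_def)
  have "real (card (sifted_primes Y a)) \<le> real (card (sifted {..<Y} ({2, 3} \<union> P) a))"
    using assms P by (intro of_nat_mono card_sifted_primes_le) fastforce
  also have "\<dots> \<le> 5 / 24 * real Y + 31"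
    using card_sifted_2_3_singletons_le[of P Y a] P by (simp add: P_def power_divide)
  also have "\<dots> < 2 * real Y / ln (real Y)"
  proof (cases "Y \<le> 900")
    case True
    then show ?thesis
      using assms by (intro affine_less_divide_ln[where x = 300 and z = 900 and t = 8]) simp_all
  next
    case False
    then show ?thesis
      using assms by (intro affine_less_divide_ln[where x = 900 and z = 9000 and t = 13]) simp_all
  qed
  finally show ?thesis .
qed

lemma card_sifted_primes_selberg_le:
  fixes z Y :: nat
  assumes z: "31 \<le> z" "z \<le> Y"
  defines "q \<equiv> ln (3 * (real z + 1)) + 3 / 5"
  shows "real (card (sifted_primes Y a)) \<le> real Y / q + 2 * (18 / 11 * real z / q)\<^sup>2"
proof -
  let ?D = "prime_sets_upto z"
  define L where "L = selberg_main_sum real ?D"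
  define R where "R = selberg_error_sum real ?D"
  interpret selberg_sieve ?D real
    using z(1) by (intro selberg_sieve_prime_sets_upto) simp
  have "0 < q" unfolding q_def by (intro add_nonneg_pos ln_ge_zero) auto
  have L: "q \<le> 3 * L"
    using sum_inverse_coprime6_upto_ge[OF z(1)] selberg_main_sum_prime_sets_upto_ge[of z] z(1)
    unfolding q_def L_def by linarith
  have R: "0 \<le> R" "3 * R \<le> 18 / 11 * real z"
    using selberg_error_sum_nonneg selberg_error_sum_prime_sets_upto_le[OF z(1)] by (simp_all add: R_def)
  have primes: "prime p" "5 \<le> p" "p \<le> Y" if "p \<in> \<Union>?D" for p
    using prime_sets_upto_memD[OF that] z(2) by simp_all
  have "real (card (sifted_primes Y a)) \<le> real (card (sifted {..<Y} ({2, 3} \<union> \<Union>?D) a))"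
    using z primes(1,3) by (intro of_nat_mono card_sifted_primes_le) auto
  also have "\<dots> \<le> real Y / (3 * L) + 2 * (R / L)\<^sup>2"
    unfolding L_def R_def using primes(1,2) by (intro card_sifted_2_3_le finite_downset_axioms) blast
  also have "\<dots> = real Y / (3 * L) + 2 * (3 * R / (3 * L))\<^sup>2" by simp
  also have "\<dots> \<le> real Y / q + 2 * (18 / 11 * real z / q)\<^sup>2"
    using \<open>0 < q\<close> L R by (intro add_mono mult_left_mono power_mono frac_le divide_nonneg_nonneg) auto
  finally show ?thesis .
qed

lemma secondary_term_absorbs_error:
  fixes h X :: real
  assumes "0 < h" "0 < X"
  shows "X / (h + 3 / 5) + 72 / 121 * X / (h + 3 / 5)\<^sup>2 < X / h"
proof -
  define q where "q = h + 3 / 5"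
  have "q > 0" using assms by (simp add: q_def)
  have "h * (q + 72 / 121) < q\<^sup>2"
    using assms by (simp add: q_def power2_eq_square algebra_simps)
  then have "(q + 72 / 121) / q\<^sup>2 < 1 / h"
    using assms \<open>q > 0\<close> by (simp add: divide_simps mult.commute)
  then have "X * ((q + 72 / 121) / q\<^sup>2) < X * (1 / h)"
    using assms by (intro mult_strict_left_mono)
  moreover have "X * ((q + 72 / 121) / q\<^sup>2) = X / q + 72 / 121 * X / q\<^sup>2"
    using \<open>q > 0\<close> by (simp add: power2_eq_square field_simps)
  ultimately show ?thesis by (simp add: q_def)
qed

lemma card_sifted_primes_less_ge_9000:
  fixes Y :: nat
  assumes Y: "9000 \<le> Y"
  shows "real (card (sifted_primes Y a)) < 2 * real Y / ln (real Y)"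
proof -
  define z where "z = nat \<lfloor>sqrt (real Y) / 3\<rfloor>"
  define h where "h = ln (real Y) / 2"
  define q where "q = h + 3 / 5"
  have sqrt_ge: "93 \<le> sqrt (real Y)" using Y by (intro real_le_rsqrt) simp
  then have z: "real z \<le> sqrt (real Y) / 3" "sqrt (real Y) / 3 < real z + 1"
    unfolding z_def by linarith+
  have "31 \<le> z" using z(2) sqrt_ge by linarith
  have "sqrt (real Y) \<le> real Y" using Y by (intro real_le_lsqrt) (simp_all add: power2_eq_square)
  then have "z \<le> Y" using z(1) sqrt_ge by linarith
  have "h > 0" using Y by (simp add: h_def)
  have "h = ln (sqrt (real Y))" using Y by (simp add: h_def ln_sqrt)
  also have "\<dots> \<le> ln (3 * (real z + 1))" using z(2) Y by (subst ln_le_cancel_iff) simp_all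
  finally have q: "q \<le> ln (3 * (real z + 1)) + 3 / 5" "0 < q" using \<open>h > 0\<close> by (simp_all add: q_def)
  have "real (card (sifted_primes Y a)) \<le> real Y / (ln (3 * (real z + 1)) + 3 / 5)
      + 2 * (18 / 11 * real z / (ln (3 * (real z + 1)) + 3 / 5))\<^sup>2"
    using \<open>31 \<le> z\<close> \<open>z \<le> Y\<close> by (rule card_sifted_primes_selberg_le)
  also have "\<dots> \<le> real Y / q + 2 * (18 / 11 * (sqrt (real Y) / 3) / q)\<^sup>2"
    using q z(1) by (intro add_mono mult_left_mono power_mono frac_le divide_nonneg_nonneg) auto
  also have "\<dots> = real Y / q + 72 / 121 * real Y / q\<^sup>2"
    by (simp add: power_divide power_mult_distrib)
  also have "\<dots> < real Y / h"
    using \<open>h > 0\<close> Y unfolding q_def by (intro secondary_term_absorbs_error) auto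
  also have "\<dots> = 2 * real Y / ln (real Y)" by (simp add: h_def)
  finally show ?thesis .
qed

theorem card_sifted_primes_less:
  fixes Y :: nat
  assumes "3 \<le> Y"
  shows "real (card (sifted_primes Y a)) < 2 * real Y / ln (real Y)"
proof -
  consider "Y \<le> 300" | "300 \<le> Y" "Y \<le> 9000" | "9000 \<le> Y" by linarith
  then show ?thesis
    by cases (use assms card_sifted_primes_less_upto_300 card_sifted_primes_less_upto_9000
      card_sifted_primes_less_ge_9000 in blast)+
qed

section \<open>The Brun--Titchmarsh inequality\<close>

lemma exists_sparse_residue_class:
  fixes B :: "nat set" and p :: nat
  assumes "finite B" "p > 0"
  shows "\<exists>r. real (card {t \<in> B. [t = r] (mod p)}) \<le> real (card B) / real p"
proof (rule ccontr)
  assume "\<nexists>r. real (card {t \<in> B. [t = r] (mod p)}) \<le> real (card B) / real p"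
  then have dense: "real (card B) / real p < real (card {t \<in> B. [t = r] (mod p)})" for r
    by (meson not_le)
  have "real (card B) = (\<Sum>r<p. real (card B) / real p)" using assms by simp
  also have "\<dots> < (\<Sum>r<p. real (card {t \<in> B. [t = r] (mod p)}))"
    using assms dense by (intro sum_strict_mono) auto
  also have "\<dots> = (\<Sum>r<p. \<Sum>t | t \<in> B \<and> t mod p = r. 1)"
    by (intro sum.cong refl) (simp add: Cong.cong_def)
  also have "\<dots> = (\<Sum>t\<in>B. 1)"
    using assms by (intro sum.group) auto
  finally show False by simp
qed

lemma exists_dense_sifted:
  fixes A P :: "nat set"
  assumes "finite A" "finite P" "\<And>p. p \<in> P \<Longrightarrow> p > 0"
  shows "\<exists>a. real (card A) * (\<Prod>p\<in>P. 1 - 1 / real p) \<le> real (card (sifted A P a))"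
  using assms(2,3)
proof (induction P rule: finite_induct)
  case empty
  show ?case by (simp add: sifted_def)
next
  case (insert p P)
  then obtain a where a: "real (card A) * (\<Prod>p\<in>P. 1 - 1 / real p) \<le> real (card (sifted A P a))"
    by auto
  let ?B = "sifted A P a"
  have B: "finite ?B" using assms(1) by (rule finite_sifted)
  have p: "p > 0" using insert.prems by simp
  obtain r where r: "real (card {t \<in> ?B. [t = r] (mod p)}) \<le> real (card ?B) / real p"
    using exists_sparse_residue_class[OF B p] by blast
  have "real (card A) * (\<Prod>p\<in>insert p P. 1 - 1 / real p) =
      (real (card A) * (\<Prod>p\<in>P. 1 - 1 / real p)) * (1 - 1 / real p)"
    using insert.hyps by (simp add: mult_ac)
  also have "\<dots> \<le> real (card ?B) * (1 - 1 / real p)"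
    using a p by (intro mult_right_mono) auto
  also have "\<dots> \<le> real (card ?B) - real (card {t \<in> ?B. [t = r] (mod p)})"
    using r by (simp add: algebra_simps)
  also have "\<dots> = real (card (?B - {t \<in> ?B. [t = r] (mod p)}))"
    using B by (simp add: card_Diff_subset of_nat_diff card_mono)
  also have "?B - {t \<in> ?B. [t = r] (mod p)} = sifted A (insert p P) (a(p := r))"
    using insert.hyps(2) by (auto simp: sifted_def)
  finally show ?case by blast
qed

lemma prime_progression_avoids_residue_class:
  fixes p q u :: nat
  assumes p: "prime p" "p < u" "coprime q p"
  shows "\<exists>c. \<forall>j. prime (u + j * q) \<longrightarrow> \<not> [j = c] (mod p)"
proof -
  obtain x where x: "[q * x = 1] (mod p)" using cong_solve_coprime_nat[OF p(3)] by auto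
  have "\<not> [j = x * ((p - 1) * u)] (mod p)" if "prime (u + j * q)" for j
  proof
    assume "[j = x * ((p - 1) * u)] (mod p)"
    then have "[u + j * q = u + x * ((p - 1) * u) * q] (mod p)"
      by (intro cong_add cong_mult cong_refl)
    also have "u + x * ((p - 1) * u) * q = u + (q * x) * ((p - 1) * u)" by (simp add: mult_ac)
    also have "[\<dots> = u + 1 * ((p - 1) * u)] (mod p)"
      using x by (intro cong_add cong_mult cong_refl)
    also have "u + 1 * ((p - 1) * u) = p * u" using prime_gt_0_nat[OF p(1)] by (cases p) auto
    finally have "p dvd u + j * q" by (simp add: Cong.cong_def mod_eq_0_iff_dvd)
    then have "p = u + j * q" using p(1) that primes_dvd_imp_eq by blast
    then show False using p(2) by simp
  qed
  then show ?thesis by blast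
qed

theorem brun_titchmarsh:
  fixes q u Y :: nat
  assumes q: "q > 0" and Y: "3 \<le> Y" "Y < u"
  shows "real (card {j. j < Y \<and> prime (u + j * q)}) * (real (totient q) / real q) <
    2 * real Y / ln (real Y)"
proof -
  define A where "A = {j. j < Y \<and> prime (u + j * q)}"
  have "finite A" by (simp add: A_def)
  then obtain a where a: "real (card A) * (\<Prod>p\<in>prime_factors q. 1 - 1 / real p)
      \<le> real (card (sifted A (prime_factors q) a))"
    using exists_dense_sifted[of A "prime_factors q"]
    by (auto simp: prime_gt_0_nat in_prime_factors_imp_prime)
  have "\<exists>c. \<forall>j\<in>sifted A (prime_factors q) a. \<not> [j = c] (mod p)" if p: "prime p" "p \<le> Y" for p
  proof (cases "p dvd q")
    case True
    then have "p \<in> prime_factors q" using p q by (simp add: prime_factors_dvd)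
    then show ?thesis by (auto simp: sifted_def)
  next
    case False
    then have "coprime q p" using p(1) by (metis coprime_commute prime_imp_coprime)
    then show ?thesis
      using prime_progression_avoids_residue_class[of p u q] p Y(2) by (auto simp: A_def sifted_def)
  qed
  then obtain c where "\<And>p. prime p \<Longrightarrow> p \<le> Y \<Longrightarrow> \<forall>j\<in>sifted A (prime_factors q) a. \<not> [j = c p] (mod p)"
    by metis
  then have "sifted A (prime_factors q) a \<subseteq> sifted_primes Y c"
    by (auto simp: A_def sifted_def)
  then have "card (sifted A (prime_factors q) a) \<le> card (sifted_primes Y c)"
    by (intro card_mono finite_sifted) auto
  moreover have "real (totient q) / real q = (\<Prod>p\<in>prime_factors q. 1 - 1 / real p)"
    using q by (simp add: totient_formula2)
  ultimately show ?thesis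
    using a card_sifted_primes_less[OF Y(1), of c] unfolding A_def[symmetric] by simp
qed

lemma totient_ratio_power_ge:
  fixes g N :: nat
  assumes "g > 0"
  shows "real (totient g) / real g \<le> real (totient (g ^ N)) / real (g ^ N)"
proof (cases "N = 0")
  case True
  then show ?thesis using assms by (simp add: totient_le)
next
  case False
  then show ?thesis using assms by (simp add: totient_formula2 prime_factors_power)
qed

section \<open>Primes all of whose truncations are prime\<close>

text \<open>Unlike in the usual definition, digits may be \<open>0\<close>.\<close>

definition left_truncatable_primes :: "nat \<Rightarrow> nat \<Rightarrow> nat set" where
  "left_truncatable_primes g N = {u. u < g ^ N \<and> (\<forall>n\<in>{1..N}. prime (u mod g ^ n))}"

lemma finite_left_truncatable_primes: "finite (left_truncatable_primes g N)"
  by (rule finite_subset[of _ "{..<g ^ N}"]) (auto simp: left_truncatable_primes_def)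

lemma trunc_Suc: "trunc d g (Suc n) = trunc d g n + d n * g ^ n"
  by (simp add: trunc_def)

lemma trunc_less:
  assumes "\<And>i. d i < g"
  shows "trunc d g n < g ^ n"
proof (induction n)
  case 0
  show ?case by (simp add: trunc_def)
next
  case (Suc n)
  have "Suc (d n) * g ^ n \<le> g * g ^ n" using assms[of n] by (intro mult_right_mono) auto
  then show ?case using Suc by (simp add: trunc_Suc)
qed

lemma trunc_mod:
  assumes "\<And>i. d i < g" "n \<le> N"
  shows "trunc d g N mod g ^ n = trunc d g n"
  using assms(2)
proof (induction N rule: dec_induct)
  case base
  show ?case using trunc_less[of d g n] assms(1) by simp
next
  case (step N)
  have "g ^ n dvd d N * g ^ N" using step.hyps by (simp add: le_imp_power_dvd)
  then have "trunc d g (Suc N) mod g ^ n = trunc d g N mod g ^ n"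
    unfolding trunc_Suc by (metis add.right_neutral mod_add_right_eq mod_eq_0_iff_dvd)
  then show ?case using step.IH by simp
qed

lemma inj_on_trunc: "inj_on (\<lambda>d. trunc d g N) (digit_seqs g N)"
proof (rule inj_onI, rule ext)
  fix d e i
  assume "d \<in> digit_seqs g N" "e \<in> digit_seqs g N" and eq: "trunc d g N = trunc e g N"
  then have d: "\<And>i. d i < g" "\<And>i. i \<ge> N \<Longrightarrow> d i = 0" and e: "\<And>i. e i < g" "\<And>i. i \<ge> N \<Longrightarrow> e i = 0"
    by (auto simp: digit_seqs_def)
  show "d i = e i"
  proof (cases "i < N")
    case True
    have "trunc d g n = trunc e g n" if "n \<le> N" for n
      using trunc_mod[of d g n N] trunc_mod[of e g n N] d e that eq by simp
    from this[of i] this[of "Suc i"] have "d i * g ^ i = e i * g ^ i"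
      using True by (simp add: trunc_Suc)
    then show ?thesis using d(1)[of i] by simp
  qed (use d e in auto)
qed

lemma P_count_le_card_left_truncatable_primes:
  assumes "g \<ge> 3"
  shows "P_count g N \<le> card (left_truncatable_primes g N)"
  unfolding P_count_def
proof (rule card_inj_on_le)
  show "inj_on (\<lambda>d. trunc d g N) {d \<in> digit_seqs g N. prime_trunc_count d g N = N - eta g}"
    using inj_on_trunc by (rule inj_on_subset) auto
  show "(\<lambda>d. trunc d g N) ` {d \<in> digit_seqs g N. prime_trunc_count d g N = N - eta g}
      \<subseteq> left_truncatable_primes g N"
  proof safe
    fix d assume d: "d \<in> digit_seqs g N" "prime_trunc_count d g N = N - eta g"
    then have digits: "\<And>i. d i < g" by (simp add: digit_seqs_def)
    have "card {n \<in> {1..N}. prime (trunc d g n)} = card {1..N}"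
      using d assms by (simp add: prime_trunc_count_def eta_def)
    then have "{n \<in> {1..N}. prime (trunc d g n)} = {1..N}" by (intro card_subset_eq) auto
    then have "prime (trunc d g n)" if "n \<in> {1..N}" for n using that by blast
    then show "trunc d g N \<in> left_truncatable_primes g N"
      using trunc_less[of d g N] trunc_mod[of d g _ N] digits
      by (auto simp: left_truncatable_primes_def)
  qed
qed (rule finite_left_truncatable_primes)

lemma left_truncatable_primes_add_decomposition:
  assumes v: "v \<in> left_truncatable_primes g (N + m)" and "g > 0" "m \<ge> 1"
  shows "v mod g ^ N \<in> left_truncatable_primes g N" "v div g ^ N < g ^ m"
    "prime (v mod g ^ N + v div g ^ N * g ^ N)"
proof -
  have "v < g ^ N * g ^ m" using v by (simp add: left_truncatable_primes_def power_add)
  then show "v div g ^ N < g ^ m" by (simp add: less_mult_imp_div_less mult.commute)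
  have "(v mod g ^ N) mod g ^ n = v mod g ^ n" if "n \<le> N" for n
    using that by (simp add: mod_mod_cancel le_imp_power_dvd)
  then show "v mod g ^ N \<in> left_truncatable_primes g N"
    using v \<open>g > 0\<close> by (auto simp: left_truncatable_primes_def)
  have "N + m \<in> {1..N + m}" using \<open>m \<ge> 1\<close> by simp
  then have "prime (v mod g ^ (N + m))" using v unfolding left_truncatable_primes_def by blast
  then show "prime (v mod g ^ N + v div g ^ N * g ^ N)"
    using v unfolding mod_div_mult_eq by (simp add: left_truncatable_primes_def)
qed

lemma card_left_truncatable_primes_add_le:
  fixes g m N s :: nat
  defines "Y \<equiv> g ^ m"
  assumes g: "g > 0" and m: "m \<ge> 1"
    and s: "\<And>u. u > Y \<Longrightarrow> card {j. j < Y \<and> prime (u + j * g ^ N)} \<le> s"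
  shows "card (left_truncatable_primes g (N + m)) \<le>
    s * card (left_truncatable_primes g N) + (Y + 1) * Y"
proof -
  let ?W = "left_truncatable_primes g" and ?J = "\<lambda>u. {j. j < Y \<and> prime (u + j * g ^ N)}"
  let ?split = "\<lambda>v. (v mod g ^ N, v div g ^ N)"
  have "inj_on ?split (?W (N + m))"
    by (rule inj_onI) (metis div_mod_decomp prod.inject)
  moreover have "?split ` ?W (N + m) \<subseteq> Sigma (?W N) ?J"
    using left_truncatable_primes_add_decomposition[of _ g N m] g m by (auto simp: Y_def)
  ultimately have "card (?W (N + m)) \<le> card (Sigma (?W N) ?J)"
    using finite_left_truncatable_primes by (intro card_inj_on_le) auto
  also have "\<dots> = (\<Sum>u\<in>?W N. card (?J u))" using finite_left_truncatable_primes by simp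
  also have "\<dots> \<le> (\<Sum>u\<in>?W N. s + (if u \<le> Y then Y else 0))"
  proof (intro sum_mono)
    fix u
    have "card (?J u) \<le> card {..<Y}" by (intro card_mono) auto
    then show "card (?J u) \<le> s + (if u \<le> Y then Y else 0)" using s[of u] by auto
  qed
  also have "\<dots> = s * card (?W N) + Y * card {u \<in> ?W N. u \<le> Y}"
    using finite_left_truncatable_primes[of g N] by (simp add: sum.distrib sum.If_cases Int_def)
  also have "\<dots> \<le> s * card (?W N) + Y * card {..Y}"
    by (intro add_left_mono mult_left_mono card_mono) auto
  finally show ?thesis by (simp add: algebra_simps)
qed

section \<open>The growth rate\<close>

lemma linear_recurrence_le:
  fixes x :: "nat \<Rightarrow> real"
  assumes "x 0 \<le> M" "\<And>k. x (Suc k) \<le> \<sigma> * x k + K"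
    and "0 \<le> \<sigma>" "\<sigma> < \<tau>" "1 \<le> \<tau>" "0 \<le> K" "0 \<le> M"
  shows "x k \<le> (M + K / (\<tau> - \<sigma>)) * \<tau> ^ k"
proof (induction k)
  case 0
  have "K / (\<tau> - \<sigma>) \<ge> 0" using assms by simp
  then show ?case using assms(1) by simp
next
  case (Suc k)
  define C where "C = M + K / (\<tau> - \<sigma>)"
  have "K = K / (\<tau> - \<sigma>) * (\<tau> - \<sigma>)" using assms by simp
  also have "\<dots> \<le> C * (\<tau> - \<sigma>)" using assms unfolding C_def by (intro mult_right_mono) auto
  also have "\<dots> * 1 \<le> C * (\<tau> - \<sigma>) * \<tau> ^ k"
    using assms unfolding C_def by (intro mult_left_mono mult_nonneg_nonneg one_le_power) auto
  finally have K: "K \<le> C * (\<tau> - \<sigma>) * \<tau> ^ k" by simp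
  have "\<sigma> * x k \<le> \<sigma> * (C * \<tau> ^ k)" using Suc assms unfolding C_def by (intro mult_left_mono)
  then show ?case using assms(2)[of k] K unfolding C_def[symmetric] by (simp add: algebra_simps)
qed

lemma eventually_le_power_of_recurrence:
  fixes x :: "nat \<Rightarrow> real"
  assumes m: "0 < m" and recurrence: "\<And>N. x (N + m) \<le> \<sigma> * x N + K"
    and \<sigma>: "0 \<le> \<sigma>" "\<sigma> < \<gamma> ^ m" and \<gamma>: "1 < \<gamma>"
  shows "\<forall>\<^sub>F N in sequentially. x N \<le> \<gamma> ^ N"
proof -
  define M where "M = (\<Sum>i<m. \<bar>x i\<bar>)"
  define \<tau> where "\<tau> = (max \<sigma> 1 + \<gamma> ^ m) / 2"
  define C where "C = M + \<bar>K\<bar> / (\<tau> - \<sigma>)"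
  have "1 < \<gamma> ^ m" using m \<gamma> by (simp add: one_less_power)
  then have \<tau>: "\<sigma> < \<tau>" "1 \<le> \<tau>" "\<tau> < \<gamma> ^ m" unfolding \<tau>_def using \<sigma> by (auto simp: max_def)
  have bound: "x N \<le> C * \<tau> ^ (N div m)" for N
  proof -
    have "\<bar>x (N mod m)\<bar> \<le> M" unfolding M_def using m by (intro member_le_sum) auto
    then have "x (N mod m + m * 0) \<le> M" by simp
    moreover have "x (N mod m + m * Suc k) \<le> \<sigma> * x (N mod m + m * k) + \<bar>K\<bar>" for k
      using recurrence[of "N mod m + m * k"] by (simp add: add_ac)
    ultimately have "x (N mod m + m * (N div m)) \<le> C * \<tau> ^ (N div m)"
      unfolding C_def using \<sigma> \<tau> by (intro linear_recurrence_le) (auto simp: M_def intro: sum_nonneg)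
    then show ?thesis by simp
  qed
  obtain k0 where k0: "C < (\<gamma> ^ m / \<tau>) ^ k0" using real_arch_pow[of "\<gamma> ^ m / \<tau>" C] \<tau> by auto
  have "x N \<le> \<gamma> ^ N" if "m * k0 \<le> N" for N
  proof -
    have "k0 \<le> N div m" using that m by (simp add: less_eq_div_iff_mult_less_eq mult.commute)
    then have "(\<gamma> ^ m / \<tau>) ^ k0 \<le> (\<gamma> ^ m / \<tau>) ^ (N div m)" using \<tau> by (intro power_increasing) auto
    then have "C \<le> (\<gamma> ^ m / \<tau>) ^ (N div m)" using k0 by linarith
    then have "C * \<tau> ^ (N div m) \<le> (\<gamma> ^ m / \<tau>) ^ (N div m) * \<tau> ^ (N div m)"
      using \<tau> by (intro mult_right_mono) auto
    also have "\<dots> = \<gamma> ^ (m * (N div m))" using \<tau> by (simp add: power_divide power_mult)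
    also have "\<dots> \<le> \<gamma> ^ N" using \<gamma> by (intro power_increasing) auto
    finally show ?thesis using bound[of N] by linarith
  qed
  then show ?thesis unfolding eventually_sequentially by blast
qed

lemma power_mult_gamma_term:
  assumes g: "g \<ge> 3" and m: "m \<ge> 1"
  shows "(real g * gamma_term g m) ^ m =
    2 * real (g ^ m) / ln (real (g ^ m)) * (real g / real (totient g))"
proof -
  define b where "b = 2 * real g / (real m * real (totient g) * ln (real g))"
  have "b > 0" unfolding b_def using g m by simp
  then have "gamma_term g m ^ m = b"
    using m unfolding gamma_term_def b_def[symmetric] by (simp add: powr_power)
  then have "(real g * gamma_term g m) ^ m = real (g ^ m) * b" by (simp add: power_mult_distrib)
  also have "\<dots> = 2 * real (g ^ m) / (real m * ln (real g)) * (real g / real (totient g))"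
    by (simp add: b_def mult_ac)
  also have "real m * ln (real g) = ln (real (g ^ m))" using g by (simp add: ln_realpow)
  finally show ?thesis .
qed

lemma mult_gamma_term_gt_1:
  assumes g: "g \<ge> 3" and m: "m \<ge> 1"
  shows "1 < real g * gamma_term g m"
proof -
  define Y where "Y = g ^ m"
  have Y: "3 \<le> Y" unfolding Y_def using g m self_le_power[of g m] by linarith
  have "ln (real Y) < 2 * real Y" using ln_bound[of "real Y"] Y by simp
  then have "1 < 2 * real Y / ln (real Y)" using Y by (simp add: pos_less_divide_eq)
  moreover have "1 \<le> real g / real (totient g)" using g by (simp add: totient_le)
  ultimately have "1 * 1 < 2 * real Y / ln (real Y) * (real g / real (totient g))"
    by (intro mult_less_le_imp_less) auto
  also have "\<dots> = (real g * gamma_term g m) ^ m"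
    unfolding Y_def by (rule power_mult_gamma_term[OF g m, symmetric])
  finally have "1 < (real g * gamma_term g m) ^ m" by simp
  moreover have "0 \<le> real g * gamma_term g m" by (simp add: gamma_term_def)
  ultimately show ?thesis by (meson not_le power_le_one)
qed

lemma card_prime_extensions_less:
  fixes g m N u :: nat
  assumes g: "g \<ge> 3" and m: "m \<ge> 1" and u: "g ^ m < u"
  shows "real (card {j. j < g ^ m \<and> prime (u + j * g ^ N)}) < (real g * gamma_term g m) ^ m"
proof -
  let ?n = "real (card {j. j < g ^ m \<and> prime (u + j * g ^ N)})"
  have "3 \<le> g ^ m" using g m self_le_power[of g m] by linarith
  have "?n * (real (totient g) / real g) \<le> ?n * (real (totient (g ^ N)) / real (g ^ N))"
    using g by (intro mult_left_mono totient_ratio_power_ge) auto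
  also have "\<dots> < 2 * real (g ^ m) / ln (real (g ^ m))"
    using g \<open>3 \<le> g ^ m\<close> u by (intro brun_titchmarsh) auto
  finally have "?n * (real (totient g) / real g) * (real g / real (totient g)) <
      2 * real (g ^ m) / ln (real (g ^ m)) * (real g / real (totient g))"
    using g by (intro mult_strict_right_mono) auto
  then show ?thesis unfolding power_mult_gamma_term[OF g m] using g by simp
qed

theorem theorem3p1:
  "\<exists>C::real. C > 0 \<and>
     (\<forall>g::nat. g \<ge> 3 \<longrightarrow>
        (\<exists>N0::nat. \<forall>N\<ge>N0. real (P_count g N) \<le> C * gamma_const g ^ N))"
proof (rule exI[of _ 1], intro conjI allI impI)
  fix g :: nat assume g: "g \<ge> 3"
  obtain m where m: "m \<ge> 1" and gamma: "gamma_const g = real g * gamma_term g m"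
    using gamma_min_attained[OF g] by blast
  define s where "s = nat (\<lceil>gamma_const g ^ m\<rceil> - 1)"
  let ?x = "\<lambda>N. card (left_truncatable_primes g N)"
  have gt_1: "1 < gamma_const g" unfolding gamma using g m by (rule mult_gamma_term_gt_1)
  have "card {j. j < g ^ m \<and> prime (u + j * g ^ N)} \<le> s" if "u > g ^ m" for u N
    using card_prime_extensions_less[OF g m that, of N] unfolding s_def gamma by linarith
  then have "?x (N + m) \<le> s * ?x N + (g ^ m + 1) * g ^ m" for N
    using g m by (intro card_left_truncatable_primes_add_le) auto
  then have "real (?x (N + m)) \<le> real s * real (?x N) + real ((g ^ m + 1) * g ^ m)" for N
    by (simp only: of_nat_le_iff flip: of_nat_mult of_nat_add)
  moreover have "real s < gamma_const g ^ m"
    using one_less_power[OF gt_1, of m] m unfolding s_def by linarith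
  ultimately have "\<forall>\<^sub>F N in sequentially. real (?x N) \<le> gamma_const g ^ N"
    using gt_1 m by (intro eventually_le_power_of_recurrence) auto
  then obtain N0 where "\<And>N. N \<ge> N0 \<Longrightarrow> real (?x N) \<le> gamma_const g ^ N"
    unfolding eventually_sequentially by blast
  then show "\<exists>N0. \<forall>N\<ge>N0. real (P_count g N) \<le> 1 * gamma_const g ^ N"
    using P_count_le_card_left_truncatable_primes[OF g] by (metis mult_1 of_nat_mono order_trans)
qed simp

end
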